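(* Let $X$ be a real or complex Banach space admitting an almost symplectic structure. Then either $X$ or its (closed) hyperplanes admit a symplectic structure. In particular, $X$ is reflexive.
   Context: For a real Banach space $X$ and an operator $\alpha:X\to X^*$, $\alpha^*:X^{**}\to X^*$ denotes the adjoint, regarded on $X\subseteq X^{**}$ through the canonical embedding, so $(\alpha^*x)(y)=\alpha(y)(x)$ for $x,y\in X$. For a complex Banach space $X$, $\overline X^*$ denotes the space of bounded conjugate-linear functionals on $X$ (conjugate dual), and for a linear operator $\alpha:X\to\overline X^*$, $\overline\alpha^*$ denotes the operator given on $X$ by $(\overline\alpha^*x)(y)=\overline{\alpha(y)(x)}$. An isomorphism (onto) $\alpha:X\to X^*$ (resp. $\alpha:X\to\overline X^*$ in the complex case) is almost symplectic if $\alpha+\alpha^*$ (resp. $\alpha+\overline\alpha^*$) is strictly singular; $X$ admits an almost symplectic structure if such an $\alpha$ exists. A real (resp. complex) Banach space $Y$ admits a symplectic structure if there is an isomorphism $\alpha$ of $Y$ onto $Y^*$ (resp. onto $\overline Y^*$) with $\alpha^*=-\alpha$ (resp. $\overline\alpha^*=-\alpha$). An operator is strictly singular if its restriction to no infinite-dimensional closed subspace is an isomorphism onto its image. *)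

theory Defs
  imports "HOL-Analysis.Analysis" "HOL-Library.Function_Algebras"
begin

text \<open>
  Subspaces of a Banach space and their duals are handled as normed spaces with an explicit
  carrier; addition is that of the ambient type (pointwise for functions).
  The scalars 'k are meant to be \<open>real\<close> or \<open>complex\<close>. Real and complex scalars are treated
  together through a parameter \<open>cj\<close>, which is \<open>id\<close> over the reals and \<open>cnj\<close> in the conjugate
  constructions over the complex numbers.
\<close>

record ('k, 'v) normed_space =
  points :: "'v set"
  scl :: "'k \<Rightarrow> 'v \<Rightarrow> 'v"
  nrm :: "'v \<Rightarrow> real"

locale complex_banach = vector_space scaleC
  for scaleC :: "complex \<Rightarrow> 'a::banach \<Rightarrow> 'a" +
  assumes scaleC_of_real: "scaleC (of_real r) x = r *\<^sub>R x"
    and norm_scaleC: "norm (scaleC c x) = cmod c * norm x"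

definition normed_subspace ::
  "('k \<Rightarrow> 'a::real_normed_vector \<Rightarrow> 'a) \<Rightarrow> 'a set \<Rightarrow> ('k, 'a) normed_space"
  where "normed_subspace smul V = \<lparr>points = V, scl = smul, nrm = norm\<rparr>"

definition bounded_operator ::
  "('k, 'v::ab_group_add) normed_space \<Rightarrow> ('k, 'w::ab_group_add) normed_space \<Rightarrow> ('v \<Rightarrow> 'w) \<Rightarrow> bool"
  where "bounded_operator X Z T \<longleftrightarrow>
    (\<forall>x\<in>points X. T x \<in> points Z) \<and>
    (\<forall>x\<in>points X. \<forall>y\<in>points X. T (x + y) = T x + T y) \<and>
    (\<forall>c. \<forall>x\<in>points X. T (scl X c x) = scl Z c (T x)) \<and>
    (\<exists>K. \<forall>x\<in>points X. nrm Z (T x) \<le> K * nrm X x)"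

definition isomorphism ::
  "('k, 'v::ab_group_add) normed_space \<Rightarrow> ('k, 'w::ab_group_add) normed_space \<Rightarrow> ('v \<Rightarrow> 'w) \<Rightarrow> bool"
  where "isomorphism X Z T \<longleftrightarrow>
    bounded_operator X Z T \<and> bij_betw T (points X) (points Z) \<and>
    bounded_operator Z X (inv_into (points X) T)"

text \<open>
  \<open>dual id X\<close> is the space of bounded linear functionals on \<open>X\<close>, \<open>dual cnj X\<close> that of bounded
  conjugate-linear ones, both with the operator norm and pointwise operations. A functional on
  \<open>X\<close> is represented by the function extending it by 0 outside \<open>points X\<close>, so that equal
  functionals are equal functions.
\<close>

definition dual ::
  "('k \<Rightarrow> 'k) \<Rightarrow> ('k::real_normed_field, 'v::ab_group_add) normed_space \<Rightarrow> ('k, 'v \<Rightarrow> 'k) normed_space"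
  where "dual cj X = \<lparr>
    points = {f.
      (\<forall>x\<in>points X. \<forall>y\<in>points X. f (x + y) = f x + f y) \<and>
      (\<forall>c. \<forall>x\<in>points X. f (scl X c x) = cj c * f x) \<and>
      (\<exists>K. \<forall>x\<in>points X. norm (f x) \<le> K * nrm X x) \<and>
      (\<forall>x. x \<notin> points X \<longrightarrow> f x = 0)},
    scl = (\<lambda>c f x. c * f x),
    nrm = (\<lambda>f. SUP x\<in>{x \<in> points X. nrm X x \<le> 1}. norm (f x))\<rparr>"

text \<open>For \<open>\<alpha> : X \<rightarrow> dual cj X\<close>, the restriction to \<open>X\<close> of the (conjugate) adjoint.\<close>

definition adjoint_on ::
  "('k \<Rightarrow> 'k) \<Rightarrow> ('k::real_normed_field, 'v) normed_space \<Rightarrow> ('v \<Rightarrow> 'v \<Rightarrow> 'k) \<Rightarrow> 'v \<Rightarrow> 'v \<Rightarrow> 'k"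
  where "adjoint_on cj X \<alpha> x = (\<lambda>y. if y \<in> points X then cj (\<alpha> y x) else 0)"

definition infinite_dimensional :: "('k::field \<Rightarrow> 'a::ab_group_add \<Rightarrow> 'a) \<Rightarrow> 'a set \<Rightarrow> bool"
  where "infinite_dimensional smul V \<longleftrightarrow> \<not> (\<exists>B. finite B \<and> module.span smul B = V)"

text \<open>Strict singularity of an operator defined on the whole space \<open>'a\<close>.\<close>

definition strictly_singular ::
  "('k::field \<Rightarrow> 'a::real_normed_vector \<Rightarrow> 'a) \<Rightarrow> ('k, 'w::ab_group_add) normed_space \<Rightarrow> ('a \<Rightarrow> 'w) \<Rightarrow> bool"
  where "strictly_singular smul Z T \<longleftrightarrow>
    bounded_operator (normed_subspace smul UNIV) Z T \<and>
    \<not> (\<exists>V. module.subspace smul V \<and> closed V \<and> infinite_dimensional smul V \<and>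
          isomorphism (normed_subspace smul V) (Z\<lparr>points := T ` V\<rparr>) T)"

definition admits_almost_symplectic ::
  "('k::real_normed_field \<Rightarrow> 'k) \<Rightarrow> ('k \<Rightarrow> 'a::real_normed_vector \<Rightarrow> 'a) \<Rightarrow> bool"
  where "admits_almost_symplectic cj smul \<longleftrightarrow>
    (let X = normed_subspace smul UNIV in
      \<exists>\<alpha>. isomorphism X (dual cj X) \<alpha> \<and>
          strictly_singular smul (dual cj X) (\<lambda>x. \<alpha> x + adjoint_on cj X \<alpha> x))"

definition admits_symplectic ::
  "('k::real_normed_field \<Rightarrow> 'k) \<Rightarrow> ('k, 'v::ab_group_add) normed_space \<Rightarrow> bool"
  where "admits_symplectic cj Y \<longleftrightarrow>
    (\<exists>\<alpha>. isomorphism Y (dual cj Y) \<alpha> \<and> (\<forall>x\<in>points Y. adjoint_on cj Y \<alpha> x = - \<alpha> x))"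

definition closed_hyperplane :: "('k::field \<Rightarrow> 'a::real_normed_vector \<Rightarrow> 'a) \<Rightarrow> 'a set \<Rightarrow> bool"
  where "closed_hyperplane smul H \<longleftrightarrow>
    module.subspace smul H \<and> closed H \<and> (\<exists>e. e \<notin> H \<and> module.span smul (insert e H) = UNIV)"

text \<open>Over both scalar fields this uses the ordinary (linear) dual, as is usual.\<close>

definition reflexive :: "('k::real_normed_field, 'v::ab_group_add) normed_space \<Rightarrow> bool"
  where "reflexive X \<longleftrightarrow>
    (\<forall>\<Phi>\<in>points (dual id (dual id X)). \<exists>x\<in>points X. \<forall>f\<in>points (dual id X). \<Phi> f = f x)"

end

theory Submission
  imports Defs
begin

text \<open>
  Let \<open>s = \<alpha> + \<alpha>\<^sup>*\<close> and \<open>K = \<alpha>\<^sup>-\<^sup>1 s\<close>, a strictly singular operator on \<open>X\<close>. Each \<open>I - t K\<close> with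
  \<open>0 \<le> t \<le> 1\<close> is semi-Fredholm: otherwise it would be small on an infinite-dimensional closed
  subspace, on which \<open>s\<close> would then be an isomorphism. By homotopy from \<open>I\<close>, all of them are
  Fredholm of index zero. For \<open>t = 1\<close> this says that \<open>\<alpha>\<^sup>*\<close>, which is injective on \<open>X\<close>, maps \<open>X\<close> onto
  the dual; this is reflexivity.

  For \<open>t = 1/2\<close> it says that the skew form \<open>(\<alpha> - \<alpha>\<^sup>*)/2\<close> has index zero. If its kernel contains two
  independent vectors, adding \<open>f \<and> g\<close> for suitable functionals shrinks the kernel and keeps the
  form skew. When the kernel is trivial, the form is a symplectic structure on \<open>X\<close>; when it is a
  line, the form restricts to a symplectic structure on any closed hyperplane transversal to that
  line, and a reflection moves the line off any given hyperplane.
\<close>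

text \<open>The values of \<open>t\<close> come from the fact that x - t K x corresponds under
  \<alpha> to (1 - t) times \<alpha> x minus t times its adjoint: at t = 1 only the adjoint is left,
  at t = 1/2 the two weights balance and the form is skew.

  The index is never computed as a number. Index zero means that some finite-rank perturbation is an
  isomorphism, a property that is visibly stable under small perturbations. The obstacle is that it
  must also pass to limits. There the proof uses a dichotomy: a semi-Fredholm operator has a
  finite-rank perturbation that is either bounded below or maps a proper closed subspace
  isomorphically onto the whole space. The second case persists under small perturbations and
  contradicts the Fredholm alternative for an index-zero operator nearby.

  The form made from f and g has rank two, so adding it lowers the dimension of the kernel by
  exactly two. A kernel of odd dimension therefore ends as a line, which is where the hyperplanes
  come from.\<close>

section \<open>Operators on a Banach space over a normed field\<close>

text \<open>One setting for both scalar fields: \<open>smul\<close> extends the real scalar action,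
  so continuity is that of the real theory (\<open>bounded_linear\<close>), and only homogeneity
  over 'k has to be carried along.\<close>

locale scalar_banach = vector_space smul
  for smul :: "'k::real_normed_field \<Rightarrow> 'a::banach \<Rightarrow> 'a" +
  assumes smul_of_real: "smul (of_real r) x = r *\<^sub>R x"
    and norm_smul: "norm (smul c x) = norm c * norm x"
begin

definition operator :: "('a \<Rightarrow> 'a) \<Rightarrow> bool"
  where "operator A \<longleftrightarrow> bounded_linear A \<and> (\<forall>c x. A (smul c x) = smul c (A x))"

definition functional :: "('a \<Rightarrow> 'k) \<Rightarrow> bool"
  where "functional f \<longleftrightarrow> bounded_linear f \<and> (\<forall>c x. f (smul c x) = c * f x)"

definition joint_kernel :: "('a \<Rightarrow> 'k) set \<Rightarrow> 'a set"
  where "joint_kernel G = {x. \<forall>g\<in>G. g x = 0}"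

definition bounded_below_on :: "'a set \<Rightarrow> ('a \<Rightarrow> 'a) \<Rightarrow> bool"
  where "bounded_below_on V A \<longleftrightarrow> (\<exists>c>0. \<forall>x\<in>V. c * norm x \<le> norm (A x))"

text \<open>Generated by rank-one terms with bounded functionals, so that sums, ranges and closed
  finite-codimensional spaces in the kernel are all found by induction.\<close>

inductive finite_rank :: "('a \<Rightarrow> 'a) \<Rightarrow> bool" where
  zero: "finite_rank (\<lambda>x. 0)"
| step: "finite_rank R \<Longrightarrow> functional f \<Longrightarrow> finite_rank (\<lambda>x. R x + smul (f x) g)"

text \<open>Upper semi-Fredholm (finite-dimensional kernel and closed range), expressed by a lower
  bound on a closed subspace of finite codimension. Its negation directly provides almost null
  vectors in every such subspace.\<close>

definition semi_fredholm :: "('a \<Rightarrow> 'a) \<Rightarrow> bool"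
  where "semi_fredholm A \<longleftrightarrow>
    (\<exists>G. finite G \<and> (\<forall>g\<in>G. functional g) \<and> bounded_below_on (joint_kernel G) A)"

text \<open>The classical characterisation of Fredholm operators of index zero as finite-rank
  perturbations of isomorphisms; it avoids dimensions of kernels and cokernels.\<close>

definition index_zero :: "('a \<Rightarrow> 'a) \<Rightarrow> bool"
  where "index_zero A \<longleftrightarrow>
    (\<exists>R. finite_rank R \<and> bounded_below_on UNIV (\<lambda>x. A x + R x) \<and> surj (\<lambda>x. A x + R x))"

lemma operator_bounded_linear: "operator A \<Longrightarrow> bounded_linear A"
  by (simp add: operator_def)

lemma functional_bounded_linear: "functional f \<Longrightarrow> bounded_linear f"
  by (simp add: functional_def)

lemmas op_add = linear_add[OF bounded_linear.linear[OF operator_bounded_linear]]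
lemmas op_diff = linear_diff[OF bounded_linear.linear[OF operator_bounded_linear]]
lemmas op_neg = linear_neg[OF bounded_linear.linear[OF operator_bounded_linear]]
lemmas op_zero = linear_0[OF bounded_linear.linear[OF operator_bounded_linear]]
lemma op_smul: "operator A \<Longrightarrow> A (smul c x) = smul c (A x)"
  by (simp add: operator_def)

lemmas fn_add = linear_add[OF bounded_linear.linear[OF functional_bounded_linear]]
lemmas fn_diff = linear_diff[OF bounded_linear.linear[OF functional_bounded_linear]]

lemmas fn_zero = linear_0[OF bounded_linear.linear[OF functional_bounded_linear]]
lemma fn_smul: "functional f \<Longrightarrow> f (smul c x) = c * f x"
  by (simp add: functional_def)

lemma bounded_bilinear_smul: "bounded_bilinear smul"
proof (unfold_locales, goal_cases)
  case (3 r a b)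
  have "smul (r *\<^sub>R a) b = smul (of_real r) (smul a b)"
    by (simp only: scale_scale scaleR_conv_of_real)
  then show ?case by (simp only: smul_of_real)
next
  case (4 a r b)
  show ?case
    by (metis smul_of_real scale_left_commute)
next
  case 5
  show ?case by (rule exI[of _ 1]) (simp add: norm_smul)
qed (simp_all add: scale_left_distrib scale_right_distrib)

lemma bounded_linear_smul: "bounded_linear (smul c)"
  using bounded_bilinear.bounded_linear_right[OF bounded_bilinear_smul] .

lemma functionalI:
  assumes "\<And>x y. f (x + y) = f x + f y" "\<And>c x. f (smul c x) = c * f x"
    "\<And>x. norm (f x) \<le> K * norm x"
  shows "functional f"
  unfolding functional_def
proof (intro conjI allI)
  show "bounded_linear f"
  proof (rule bounded_linear_intro)
    show "f (r *\<^sub>R x) = r *\<^sub>R f x" for r x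
      using assms(2)[of "of_real r" x] by (simp add: smul_of_real scaleR_conv_of_real)
    show "norm (f x) \<le> norm x * K" for x using assms(3)[of x] by (simp add: mult.commute)
  qed (fact assms)
qed (fact assms)

lemma operatorI:
  assumes "\<And>x y. A (x + y) = A x + A y" "\<And>c x. A (smul c x) = smul c (A x)"
    "\<And>x. norm (A x) \<le> K * norm x"
  shows "operator A"
  unfolding operator_def
proof (intro conjI allI)
  show "bounded_linear A"
  proof (rule bounded_linear_intro)
    show "A (r *\<^sub>R x) = r *\<^sub>R A x" for r x
      using assms(2)[of "of_real r" x] by (simp add: smul_of_real)
    show "norm (A x) \<le> norm x * K" for x using assms(3)[of x] by (simp add: mult.commute)
  qed (fact assms)
qed (fact assms)

lemma functional_bound:
  assumes "functional f" obtains K where "K > 0" "\<And>x. norm (f x) \<le> K * norm x"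
  using bounded_linear.pos_bounded[OF functional_bounded_linear[OF assms]] by (auto simp: mult.commute)

lemma operator_bound:
  assumes "operator A" obtains K where "K > 0" "\<And>x. norm (A x) \<le> K * norm x"
  using bounded_linear.pos_bounded[OF operator_bounded_linear[OF assms]] by (auto simp: mult.commute)

lemma operator_ident: "operator (\<lambda>x. x)"
  by (simp add: operator_def bounded_linear_ident)

lemma operator_comp: "operator A \<Longrightarrow> operator B \<Longrightarrow> operator (\<lambda>x. A (B x))"
  by (auto simp: operator_def intro: bounded_linear_compose)

lemma operator_add: "operator A \<Longrightarrow> operator B \<Longrightarrow> operator (\<lambda>x. A x + B x)"
  by (auto simp: operator_def scale_right_distrib intro: bounded_linear_add)

lemma operator_diff: "operator A \<Longrightarrow> operator B \<Longrightarrow> operator (\<lambda>x. A x - B x)"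
  by (auto simp: operator_def scale_right_diff_distrib intro: bounded_linear_sub)

lemma operator_scaleR: "operator A \<Longrightarrow> operator (\<lambda>x. r *\<^sub>R A x)"
  unfolding operator_def
  by (metis bounded_linear_const_scaleR smul_of_real scale_left_commute)

lemma operator_rank_one: "functional f \<Longrightarrow> operator (\<lambda>x. smul (f x) g)"
  unfolding operator_def functional_def
  using bounded_linear_compose[OF bounded_bilinear.bounded_linear_left[OF bounded_bilinear_smul]]
  by (auto simp: scale_scale)

lemma functional_comp: "functional f \<Longrightarrow> operator A \<Longrightarrow> functional (\<lambda>x. f (A x))"
  by (auto simp: operator_def functional_def intro: bounded_linear_compose)

lemma functional_diff: "functional f \<Longrightarrow> functional g \<Longrightarrow> functional (\<lambda>x. f x - g x)"
  by (auto simp: functional_def right_diff_distrib intro: bounded_linear_sub)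

lemma functional_add: "functional f \<Longrightarrow> functional g \<Longrightarrow> functional (\<lambda>x. f x + g x)"
  by (auto simp: functional_def distrib_left intro: bounded_linear_add)

lemma functional_mult: "functional f \<Longrightarrow> functional (\<lambda>x. c * f x)"
  by (auto simp: functional_def intro: bounded_linear_const_mult)

lemma functional_sum: "(\<And>i. i \<in> I \<Longrightarrow> functional (f i)) \<Longrightarrow> functional (\<lambda>x. \<Sum>i\<in>I. f i x)"
  by (auto simp: functional_def sum_distrib_left intro: bounded_linear_sum)

lemma operator_linear: "operator A \<Longrightarrow> Vector_Spaces.linear smul smul A"
  unfolding module_hom_iff_linear[symmetric]
  by unfold_locales (auto simp: op_add op_smul)

section \<open>Finite-rank operators and joint kernels\<close>

lemma finite_rank_operator: "finite_rank R \<Longrightarrow> operator R"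
proof (induction rule: finite_rank.induct)
  case zero
  show ?case by (simp add: operator_def bounded_linear_zero)
next
  case (step R f g)
  then show ?case by (intro operator_add operator_rank_one)
qed

lemma finite_rank_add: "finite_rank S \<Longrightarrow> finite_rank R \<Longrightarrow> finite_rank (\<lambda>x. R x + S x)"
proof (induction rule: finite_rank.induct)
  case (step S f g)
  then show ?case using finite_rank.step[of "\<lambda>x. R x + S x" f g] by (simp add: add.assoc)
qed simp

lemma finite_rank_neg: "finite_rank S \<Longrightarrow> finite_rank (\<lambda>x. - S x)"
proof (induction rule: finite_rank.induct)
  case (step S f g)
  then show ?case using finite_rank.step[of "\<lambda>x. - S x" f "- g"] by simp
qed (simp add: finite_rank.zero)

lemma finite_rank_one: "functional f \<Longrightarrow> finite_rank (\<lambda>x. smul (f x) g)"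
  using finite_rank.step[OF finite_rank.zero] by simp

lemma finite_rank_range: "finite_rank R \<Longrightarrow> \<exists>B. finite B \<and> range R \<subseteq> span B"
proof (induction rule: finite_rank.induct)
  case zero
  show ?case by (rule exI[of _ "{}"]) auto
next
  case (step R f g)
  then obtain B where B: "finite B" "range R \<subseteq> span B" by blast
  have "range (\<lambda>x. R x + smul (f x) g) \<subseteq> span (insert g B)"
    using B(2) span_mono[of B "insert g B"]
    by (intro image_subsetI span_add span_scale) (auto intro: span_base)
  then show ?case using B(1) by (intro exI[of _ "insert g B"]) simp
qed

lemma finite_rank_joint_kernel:
  "finite_rank R \<Longrightarrow> \<exists>G. finite G \<and> (\<forall>g\<in>G. functional g) \<and> (\<forall>x\<in>joint_kernel G. R x = 0)"
proof (induction rule: finite_rank.induct)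
  case zero
  show ?case by (rule exI[of _ "{}"]) auto
next
  case (step R f g)
  then obtain G where "finite G" "\<forall>g\<in>G. functional g" "\<forall>x\<in>joint_kernel G. R x = 0" by blast
  then show ?case using step.hyps by (intro exI[of _ "insert f G"]) (auto simp: joint_kernel_def)
qed

lemma joint_kernel_subspace:
  assumes "\<And>g. g \<in> G \<Longrightarrow> functional g"
  shows "Real_Vector_Spaces.subspace (joint_kernel G)" "subspace (joint_kernel G)"
    "closed (joint_kernel G)"
proof -
  show "subspace (joint_kernel G)"
    using assms by (intro subspaceI) (auto simp: joint_kernel_def fn_add fn_smul fn_zero)
  then show "Real_Vector_Spaces.subspace (joint_kernel G)"
    by (metis real_vector.subspaceI smul_of_real subspace_0 subspace_add subspace_scale)
  have "joint_kernel G = (\<Inter>g\<in>G. {x. g x = 0})" by (auto simp: joint_kernel_def)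
  moreover have "closed {x. g x = 0}" if "g \<in> G" for g
    using functional_bounded_linear[OF assms[OF that]]
    by (intro closed_Collect_eq continuous_intros linear_continuous_on)
  ultimately show "closed (joint_kernel G)" by auto
qed

lemma index_zero_semi_fredholm:
  assumes "index_zero A" shows "semi_fredholm A"
proof -
  obtain R where R: "finite_rank R" "bounded_below_on UNIV (\<lambda>x. A x + R x)"
    using assms by (auto simp: index_zero_def)
  obtain G where G: "finite G" "\<forall>g\<in>G. functional g" "\<forall>x\<in>joint_kernel G. R x = 0"
    using finite_rank_joint_kernel[OF R(1)] by blast
  then show ?thesis using R(2) unfolding semi_fredholm_def bounded_below_on_def
    by (intro exI[of _ G]) (metis UNIV_I add.right_neutral)
qed

lemma index_zero_add_finite_rank:
  assumes "index_zero A" "finite_rank R" shows "index_zero (\<lambda>x. A x + R x)"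
proof -
  obtain S where S: "finite_rank S" "bounded_below_on UNIV (\<lambda>x. A x + S x)" "surj (\<lambda>x. A x + S x)"
    using assms by (auto simp: index_zero_def)
  have "finite_rank (\<lambda>x. S x + - R x)" by (intro finite_rank_add finite_rank_neg S(1) assms(2))
  then show ?thesis using S(2,3) unfolding index_zero_def
    by (intro exI[of _ "\<lambda>x. S x + - R x"]) (simp add: algebra_simps)
qed

section \<open>The Fredholm alternative for finite-rank perturbations\<close>

text \<open>Rank-nullity by counting a basis \<open>C\<close> of the span: an injective image of
  \<open>C\<close> is independent of full size, so no vector outside its span can be added;
  conversely, a spanning image with at most \<open>card C\<close> elements must be
  independent.\<close>

lemma inj_on_span_iff_surj:
  assumes A: "operator A" and B: "finite B" and inv: "A ` span B \<subseteq> span B"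
  shows "inj_on A (span B) \<longleftrightarrow> A ` span B = span B"
proof -
  interpret vector_space_pair smul smul ..
  note lin = operator_linear[OF A]
  obtain C where C: "C \<subseteq> span B" "independent C" "span B \<subseteq> span C"
    by (rule maximal_independent_subset)
  have finC: "finite C" using independent_span_bound[OF B C(2,1)] by simp
  have spanC: "span C = span B" using C span_minimal[of C "span B"] by auto
  have img: "A ` span C = span (A ` C)" using linear_span_image[OF lin] by simp
  show ?thesis
  proof
    assume inj: "inj_on A (span B)"
    have ind: "independent (A ` C)"
      using linear_independent_injective_image[OF lin C(2)] inj spanC by simp
    have card: "card (A ` C) = card C"
      using inj C(1) by (metis card_image inj_on_subset)
    have "w \<in> span (A ` C)" if w: "w \<in> span B" for w
    proof (rule ccontr)
      assume n: "w \<notin> span (A ` C)"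
      then have "independent (insert w (A ` C))" using ind by (rule independent_insertI)
      moreover have "insert w (A ` C) \<subseteq> span C" using w inv spanC C(1) by auto
      ultimately have "card (insert w (A ` C)) \<le> card C"
        using independent_span_bound[OF finC] by blast
      moreover have "w \<notin> A ` C" using n span_base[of w "A ` C"] by argo
      ultimately show False using card finC by simp
    qed
    then show "A ` span B = span B" using inv img spanC by auto
  next
    assume eq: "A ` span B = span B"
    then have sp: "span (A ` C) = span C" using img spanC by simp
    have le: "card C \<le> card (A ` C)"
      using independent_span_bound[of "A ` C" C] finC C sp span_superset by auto
    then have injC: "inj_on A C" using finC by (meson card_image_le eq_card_imp_inj_on le_antisym)
    obtain D where D: "D \<subseteq> A ` C" "independent D" "A ` C \<subseteq> span D"
      by (rule maximal_independent_subset)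
    have finD: "finite D" using D(1) finC finite_subset by blast
    have "C \<subseteq> span D"
      using D(3) sp span_superset[of C] span_minimal[of "A ` C" "span D"] by auto
    then have "card (A ` C) \<le> card D"
      using independent_span_bound[OF finD C(2)] finC card_image_le le_trans by blast
    then have "D = A ` C" using D(1) finC by (meson card_seteq finite_imageI)
    then have "inj_on A (span C)"
      using linear_inj_on_span_independent_image[OF lin _ injC] D(2) by simp
    then show "inj_on A (span B)" using spanC by simp
  qed
qed

text \<open>Let \<open>S\<close> = A + R be the isomorphism and \<open>J\<close> its inverse. Then
  \<open>F\<close> = J A equals the identity minus J R, so it is the identity modulo the
  finite-dimensional space \<open>W\<close>. The kernel of \<open>F\<close> and every obstruction to
  solving F x = y lie in \<open>W\<close>, so both properties are decided there by
  rank-nullity.\<close>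

lemma fredholm_alternative:
  assumes A: "operator A" and ind: "index_zero A"
  shows "inj A \<longleftrightarrow> surj A"
proof -
  obtain R where R: "finite_rank R" "bounded_below_on UNIV (\<lambda>x. A x + R x)" "surj (\<lambda>x. A x + R x)"
    using ind by (auto simp: index_zero_def)
  define S where "S = (\<lambda>x. A x + R x)"
  have S: "operator S" using A finite_rank_operator[OF R(1)] by (simp add: S_def operator_add)
  have "inj S"
  proof (rule injI)
    fix x y assume "S x = S y"
    then have "S (x - y) = 0" by (simp add: op_diff[OF S])
    moreover obtain c where "c > 0" "c * norm (x - y) \<le> norm (S (x - y))"
      using R(2) by (auto simp: bounded_below_on_def S_def)
    ultimately show "x = y" by (simp add: mult_le_0_iff)
  qed
  with R(3) have bij: "bij S" by (simp add: bij_def S_def)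
  obtain c where c: "c > 0" "\<And>x. c * norm x \<le> norm (S x)"
    using R(2) by (auto simp: bounded_below_on_def S_def)
  define J where "J = inv S"
  have SJ: "S (J x) = x" for x using bij by (simp add: J_def bij_is_surj surj_f_inv_f)
  have JS: "J (S x) = x" for x using bij by (simp add: J_def bij_is_inj)
  have J: "operator J"
    unfolding operator_def
  proof (intro conjI allI)
    show "bounded_linear J"
    proof (rule bounded_linear_intro[where K="1/c"])
      show "J (x + y) = J x + J y" for x y by (metis JS SJ S op_add)
      show "J (r *\<^sub>R x) = r *\<^sub>R J x" for r x by (metis JS SJ S op_smul smul_of_real)
      show "norm (J x) \<le> norm x * (1/c)" for x
        using c(2)[of "J x"] c(1) by (simp add: SJ field_simps)
    qed
    show "J (smul k x) = smul k (J x)" for k x by (metis JS SJ S op_smul)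
  qed
  define F where "F = (\<lambda>x. J (A x))"
  have F: "operator F" unfolding F_def by (rule operator_comp[OF J A])
  obtain B where B: "finite B" "range R \<subseteq> span B" using finite_rank_range[OF R(1)] by blast
  interpret vector_space_pair smul smul ..
  define W where "W = span (J ` B)"
  have JR: "J (R x) \<in> W" for x
  proof -
    have "J ` span B = W" unfolding W_def using linear_span_image[OF operator_linear[OF J]] by simp
    then show ?thesis using B(2) by auto
  qed
  have F_eq: "F x = x - J (R x)" for x
  proof -
    have "A x = S x - R x" by (simp add: S_def)
    then show ?thesis by (simp add: F_def op_diff[OF J] JS)
  qed
  have W: "subspace W" by (simp add: W_def)
  have FW: "F ` W \<subseteq> W" using W JR by (auto simp: F_eq intro!: subspace_diff)
  have fin: "inj_on F W \<longleftrightarrow> F ` W = W"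
    unfolding W_def by (rule inj_on_span_iff_surj[OF F]) (use B(1) FW in \<open>auto simp: W_def\<close>)
  have "inj A \<longleftrightarrow> inj F" unfolding F_def using SJ by (auto simp: inj_def) metis
  also have "\<dots> \<longleftrightarrow> inj_on F W"
  proof
    assume i: "inj_on F W"
    show "inj F"
    proof (rule injI)
      fix x y assume "F x = F y"
      then have z: "F (x - y) = 0" by (simp add: op_diff[OF F])
      then have "x - y = J (R (x - y))" by (simp add: F_eq)
      then have "x - y \<in> W" using JR by metis
      then show "x = y" using i z W op_zero[OF F] by (metis eq_iff_diff_eq_0 inj_onD subspace_0)
    qed
  qed (auto intro: inj_on_subset)
  also have "\<dots> \<longleftrightarrow> surj F"
    unfolding fin
  proof
    assume eq: "F ` W = W"
    have "\<exists>x. F x = y" for y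
    proof -
      \<comment> \<open>As F y = y - J (R y), a vector of \<open>W\<close> mapped to J (R y)
        corrects the error.\<close>
      obtain w where "F w = J (R y)" using JR[of y] eq by (metis imageE)
      then have "F (y + w) = y" using F_eq[of y] by (simp add: op_add[OF F])
      then show ?thesis ..
    qed
    then show "surj F" by (metis surjI surj_def)
  next
    assume s: "surj F"
    have "w \<in> F ` W" if w: "w \<in> W" for w
    proof -
      obtain x where x: "w = F x" using s by (metis surjD)
      then have "x = w + J (R x)" by (simp add: F_eq)
      then have "x \<in> W" using w JR W subspace_add by metis
      then show ?thesis using x by blast
    qed
    then show "F ` W = W" using FW by auto
  qed
  also have "\<dots> \<longleftrightarrow> surj A" unfolding F_def surj_def by (metis JS SJ)
  finally show ?thesis .
qed

section \<open>Semi-Fredholm operators\<close>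

text \<open>Adjoins the direction \<open>e\<close> to the joint kernel \<open>Y\<close> of
  \<open>G\<close>. The image of \<open>Y\<close> is complete because A is bounded below there, so A
  e has positive distance from it, and this controls the coefficient of \<open>e\<close>. The new
  functionals vanish on \<open>Y\<close> and at \<open>e\<close>; the one made from \<open>f\<close>
  would be zero and is dropped, so there is one fewer.\<close>

lemma bounded_below_extend:
  assumes A: "operator A" and G: "\<And>g. g \<in> G \<Longrightarrow> functional g"
    and bb: "bounded_below_on (joint_kernel G) A"
    and f: "f \<in> G" "f e = 1" and ran: "A e \<notin> A ` joint_kernel G"
  shows "bounded_below_on (joint_kernel ((\<lambda>g x. g x - g e * f x) ` (G - {f}))) A"
proof -
  define Y where "Y = joint_kernel G"
  note Y = joint_kernel_subspace[of G, OF G, folded Y_def]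
  obtain c where c: "c > 0" "\<And>y. y \<in> Y \<Longrightarrow> c * norm y \<le> norm (A y)"
    using bb by (auto simp: bounded_below_on_def Y_def)
  have "complete (A ` Y)"
    using c Y(3) by (intro complete_isometric_image[OF c(1) Y(1) operator_bounded_linear[OF A]])
      (auto simp: complete_eq_closed)
  then have "closed (A ` Y)" by (simp add: complete_eq_closed)
  then have "open (- (A ` Y))" by (simp add: open_Compl)
  then obtain d where d: "d > 0" "ball (A e) d \<subseteq> - (A ` Y)"
    using ran unfolding open_contains_ball Y_def by (metis ComplI)
  have dist: "d \<le> norm (A e + A y)" if "y \<in> Y" for y
  proof -
    have "A (- y) \<in> A ` Y" using that Y(2) subspace_neg by blast
    then have "A (- y) \<notin> ball (A e) d" using d(2) by blast
    then show ?thesis by (simp add: dist_norm op_neg[OF A])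
  qed
  \<comment> \<open>The distance \<open>d\<close> bounds the coefficient a; subtracting a A e then
    leaves A y, and \<open>c\<close> bounds y. Adding the two estimates gives the constant.\<close>
  have split: "norm (smul a e + y) * 1 \<le> ((1 + norm (A e) / d) / c + norm e / d) * norm (A (smul a e + y))"
    if y: "y \<in> Y" for a y
  proof -
    define N where "N = norm (A (smul a e + y))"
    have aN: "norm a * d \<le> N"
    proof (cases "a = 0")
      case False
      have "d \<le> norm (A e + A (smul (1/a) y))" using y Y(2) by (intro dist subspace_scale)
      then have "norm a * d \<le> norm a * norm (A e + A (smul (1/a) y))" by (simp add: mult_left_mono)
      also have "\<dots> = norm (smul a (A e + A (smul (1/a) y)))" by (simp add: norm_smul)
      also have "smul a (A e + A (smul (1/a) y)) = A (smul a e + y)"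
        using False by (simp add: op_add[OF A] op_smul[OF A] scale_right_distrib)
      finally show ?thesis by (simp add: N_def)
    qed (simp add: N_def)
    then have a: "norm a \<le> N / d" using d(1) by (simp add: field_simps)
    have "A y = A (smul a e + y) - smul a (A e)" by (simp add: op_add[OF A] op_smul[OF A])
    then have "norm (A y) \<le> N + norm a * norm (A e)"
      unfolding N_def norm_smul[symmetric] by (metis norm_triangle_ineq4)
    also have "\<dots> \<le> N + N / d * norm (A e)" using a by (intro add_left_mono mult_right_mono) auto
    finally have "c * norm y \<le> N * (1 + norm (A e) / d)"
      using c(2)[OF y] by (simp add: algebra_simps)
    then have ny: "norm y \<le> N * (1 + norm (A e) / d) / c" using c(1) by (simp add: field_simps)
    have "norm (smul a e + y) \<le> norm a * norm e + norm y"
      by (metis norm_smul norm_triangle_ineq)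
    also have "\<dots> \<le> N / d * norm e + N * (1 + norm (A e) / d) / c"
      using a ny by (intro add_mono mult_right_mono) auto
    finally have "norm (smul a e + y) * 1 \<le> ((1 + norm (A e) / d) / c + norm e / d) * N"
      by (simp add: algebra_simps)
    then show ?thesis unfolding N_def .
  qed
  define M where "M = (1 + norm (A e) / d) / c + norm e / d"
  have M: "M > 0" unfolding M_def using c(1) d(1)
    by (intro add_pos_nonneg divide_pos_pos) (auto simp: add_pos_nonneg)
  have "1 / M * norm x \<le> norm (A x)"
    if x: "x \<in> joint_kernel ((\<lambda>g x. g x - g e * f x) ` (G - {f}))" for x
  proof -
    define y where "y = x - smul (f x) e"
    have "g y = 0" if g: "g \<in> G" for g
    proof (cases "g = f")
      case True
      then show ?thesis using f G[OF g] by (simp add: y_def fn_diff fn_smul)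
    next
      case False
      then have "g x - g e * f x = 0" using x g by (auto simp: joint_kernel_def)
      then show ?thesis using G[OF g] by (simp add: y_def fn_diff fn_smul mult.commute)
    qed
    then have "y \<in> Y" by (simp add: Y_def joint_kernel_def)
    from split[OF this, of "f x"] have "norm x \<le> M * norm (A x)" by (simp add: y_def M_def)
    then show ?thesis using M by (simp add: field_simps)
  qed
  then show ?thesis unfolding bounded_below_on_def using M by (intro exI[of _ "1 / M"]) simp
qed

lemma normalise_functional:
  assumes "joint_kernel G \<noteq> UNIV" "\<And>g. g \<in> G \<Longrightarrow> functional g"
  obtains f e where "f \<in> G" "f e = 1" "e \<notin> joint_kernel G"
proof -
  obtain f e where f: "f \<in> G" "f e \<noteq> 0" using assms(1) by (auto simp: joint_kernel_def)
  have "f (smul (1 / f e) e) = 1" using f assms(2) by (simp add: fn_smul)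
  then have "f (smul (1 / f e) e) = 1" "smul (1 / f e) e \<notin> joint_kernel G"
    using f(1) unfolding joint_kernel_def by force+
  then show ?thesis by (rule that[OF f(1)])
qed

lemma card_reduced:
  assumes "finite G" "card G \<le> Suc n" "f \<in> G"
  shows "card (h ` (G - {f})) \<le> n"
proof -
  have "card (h ` (G - {f})) \<le> card (G - {f})" using assms by (intro card_image_le) auto
  then show ?thesis using assms by (simp add: card_Diff_singleton)
qed

lemma functional_reduced:
  assumes "\<And>g. g \<in> G \<Longrightarrow> functional g" "f \<in> G" "h \<in> (\<lambda>g x. g x - g e * f x) ` (G - {f})"
  shows "functional h"
  using assms by (auto intro!: functional_diff functional_mult)

text \<open>Injectivity keeps A e outside the image of the joint kernel for every e outside it, so
  one functional after another can be removed until the subspace is the whole space.\<close>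

lemma semi_fredholm_inj_bounded_below:
  assumes A: "operator A" and inj: "inj A" and sf: "semi_fredholm A"
  shows "bounded_below_on UNIV A"
proof -
  have "bounded_below_on UNIV A" if "finite G" "card G \<le> n" "\<And>g. g \<in> G \<Longrightarrow> functional g"
    "bounded_below_on (joint_kernel G) A" for n G
    using that
  proof (induction n arbitrary: G)
    case 0
    then show ?case by (simp add: joint_kernel_def)
  next
    case (Suc n)
    show ?case
    proof (cases "joint_kernel G = UNIV")
      case True
      then show ?thesis using Suc.prems by simp
    next
      case False
      then obtain f e where f: "f \<in> G" "f e = 1" "e \<notin> joint_kernel G"
        using normalise_functional Suc.prems(3) by metis
      have "A e \<notin> A ` joint_kernel G" using f(3) inj by (auto dest: injD)
      from bounded_below_extend[OF A Suc.prems(3,4) f(1,2) this] show ?thesis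
        using Suc.prems f functional_reduced[OF Suc.prems(3) f(1)]
        by (intro Suc.IH[of "(\<lambda>g x. g x - g e * f x) ` (G - {f})"] card_reduced) auto
    qed
  qed
  then show ?thesis using sf unfolding semi_fredholm_def by blast
qed

text \<open>The alternatives are the possible signs of the index: at most zero, or positive. In the
  induction on the number of functionals, the joint kernel \<open>Y\<close> is enlarged whenever
  some A e lies outside the image of \<open>Y\<close>. If there is none, \<open>Y\<close> already
  has the full range of A. Then either A is onto, or a rank-one term that vanishes on
  \<open>Y\<close> moves the image of some e out of this range and the enlargement can go
  on.\<close>

lemma semi_fredholm_dichotomy:
  assumes A: "operator A" and sf: "semi_fredholm A"
  shows "\<exists>R. finite_rank R \<and> (bounded_below_on UNIV (\<lambda>x. A x + R x) \<or>
    (\<exists>G. (\<forall>g\<in>G. functional g) \<and> joint_kernel G \<noteq> UNIV \<and>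
      bounded_below_on (joint_kernel G) (\<lambda>x. A x + R x) \<and>
      (\<lambda>x. A x + R x) ` joint_kernel G = UNIV))"
    (is "\<exists>R. finite_rank R \<and> ?P (\<lambda>x. A x + R x)")
proof -
  have "\<exists>R. finite_rank R \<and> ?P (\<lambda>x. A x + R x)" if "finite G" "card G \<le> n"
    "\<And>g. g \<in> G \<Longrightarrow> functional g" "bounded_below_on (joint_kernel G) A" "operator A" for n G A
    using that
  proof (induction n arbitrary: G A)
    case 0
    then have "bounded_below_on UNIV A" by (simp add: joint_kernel_def)
    then show ?case by (intro exI[of _ "\<lambda>x. 0"]) (simp add: finite_rank.zero)
  next
    case (Suc n)
    note A = Suc.prems(5)
    define Y where "Y = joint_kernel G"
    have reduce: "\<exists>R. finite_rank R \<and> ?P (\<lambda>x. B x + R x)"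
      if "operator B" "bounded_below_on Y B" "f \<in> G" "f e = 1" "B e \<notin> B ` Y" for B f e
      using bounded_below_extend[OF that(1) Suc.prems(3) that(2)[unfolded Y_def] that(3,4)] that
        Suc.prems functional_reduced[OF Suc.prems(3) that(3)]
      by (intro Suc.IH[of "(\<lambda>g x. g x - g e * f x) ` (G - {f})"] card_reduced) (auto simp: Y_def)
    consider "Y = UNIV" | e where "e \<notin> Y" "A e \<notin> A ` Y"
      | "Y \<noteq> UNIV" "\<And>e. A e \<in> A ` Y" by (metis UNIV_eq_I imageI)
    then show ?case
    proof cases
      case 1
      then show ?thesis using Suc.prems(4)
        by (intro exI[of _ "\<lambda>x. 0"]) (simp add: finite_rank.zero Y_def)
    next
      case (2 e0)
      obtain f where f: "f \<in> G" "f e0 \<noteq> 0" using 2(1) by (auto simp: Y_def joint_kernel_def)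
      define e where "e = smul (1 / f e0) e0"
      have e0: "e0 = smul (f e0) e" using f(2) by (simp add: e_def)
      have "f e = 1" using f Suc.prems(3) by (simp add: e_def fn_smul)
      moreover have "A e \<notin> A ` Y"
      proof
        assume "A e \<in> A ` Y"
        then obtain y where "y \<in> Y" "A e = A y" by blast
        then have "smul (f e0) y \<in> Y" "A e0 = A (smul (f e0) y)"
          using joint_kernel_subspace(2)[of G] Suc.prems(3) e0
          by (auto simp: Y_def op_smul[OF A] intro: subspace_scale) (metis A op_smul)
        then show False using 2(2) by blast
      qed
      ultimately show ?thesis using Suc.prems(4) A f(1) by (intro reduce[of A f e]) (auto simp: Y_def)
    next
      case 3
      show ?thesis
      proof (cases "surj A")
        case True
        then have "A ` Y = UNIV" using 3(2) by (metis UNIV_eq_I surjD)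
        then show ?thesis using Suc.prems(3,4) 3(1) unfolding Y_def
          by (intro exI[of _ "\<lambda>x. 0"] conjI disjI2 exI[of _ G]) (simp_all add: finite_rank.zero)
      next
        case False
        then obtain g where g: "g \<notin> range A" by blast
        obtain f e where f: "f \<in> G" "f e = 1" "e \<notin> joint_kernel G"
          using normalise_functional Suc.prems(3) 3(1) unfolding Y_def by metis
        have ff: "functional f" using f Suc.prems(3) by simp
        \<comment> \<open>\<open>f\<close> vanishes on \<open>Y\<close>, so the lower bound there is
          kept, while B e = A e + g cannot lie in the image of \<open>Y\<close> because
          \<open>g\<close> is outside the range of A.\<close>
        define B where "B = (\<lambda>x. A x + smul (f x) g)"
        have BY: "B y = A y" if "y \<in> Y" for y
          using that f(1) by (simp add: B_def Y_def joint_kernel_def)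
        have "B e \<notin> B ` Y"
        proof
          assume "B e \<in> B ` Y"
          then obtain y where "y \<in> Y" "A e + g = A y" using BY f(2) by (auto simp: B_def)
          then have "g = A (y - e)" using A by (simp add: op_diff) (metis add_diff_cancel_left')
          then show False using g by blast
        qed
        moreover have "operator B" unfolding B_def
          by (rule operator_add[OF A operator_rank_one[OF ff]])
        moreover have "bounded_below_on Y B"
          using Suc.prems(4) BY by (simp add: bounded_below_on_def Y_def)
        ultimately obtain R where R: "finite_rank R" "?P (\<lambda>x. B x + R x)"
          using reduce[of B f e] f(1,2) by metis
        have "finite_rank (\<lambda>x. smul (f x) g + R x)"
          by (rule finite_rank_add[OF R(1) finite_rank_one[OF ff]])
        then show ?thesis using R(2)
          by (intro exI[of _ "\<lambda>x. smul (f x) g + R x"]) (simp add: B_def add.assoc)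
      qed
    qed
  qed
  then show ?thesis using A sf unfolding semi_fredholm_def by blast
qed

text \<open>A x + D x = z is solved as a fixed point of x \<mapsto> J (z - D x), where
  \<open>J\<close> picks preimages in \<open>V\<close>. The lower bound of A on \<open>V\<close>
  makes this map a contraction with factor d / c, without any linearity of \<open>J\<close> being
  established.\<close>

lemma surj_perturbation:
  assumes A: "operator A" and D: "operator D" and V: "subspace V" "closed V"
    and bb: "\<And>x. x \<in> V \<Longrightarrow> c * norm x \<le> norm (A x)" and surj: "A ` V = UNIV"
    and d: "\<And>x. norm (D x) \<le> d * norm x" "0 \<le> d" "d < c"
  shows "(\<lambda>x. A x + D x) ` V = UNIV"
proof -
  have "\<exists>x\<in>V. A x + D x = z" for z
  proof -
    define J where "J y = (SOME x. x \<in> V \<and> A x = y)" for y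
    have J: "J y \<in> V" "A (J y) = y" for y
      unfolding J_def using surj someI_ex[of "\<lambda>x. x \<in> V \<and> A x = y"] by (metis UNIV_I imageE)+
    have c: "c > 0" using d by simp
    have "\<exists>!x\<in>V. J (z - D x) = x"
    proof (rule Banach_fix[where c="d / c"])
      show "complete V" using V by (simp add: complete_eq_closed)
      show "V \<noteq> {}" using V(1) subspace_0 by blast
      show "0 \<le> d / c" "d / c < 1" using d c by auto
      show "(\<lambda>x. J (z - D x)) ` V \<subseteq> V" using J by auto
      fix x y
      have "A (J (z - D x) - J (z - D y)) = D (y - x)"
        by (simp add: op_diff[OF A] op_diff[OF D] J)
      moreover have "J (z - D x) - J (z - D y) \<in> V" using J V(1) subspace_diff by blast
      ultimately have "c * norm (J (z - D x) - J (z - D y)) \<le> d * norm (y - x)"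
        using bb d(1) by (metis order_trans)
      then show "dist (J (z - D x)) (J (z - D y)) \<le> d / c * dist x y"
        using c by (simp add: dist_norm norm_minus_commute field_simps)
    qed
    then obtain x where "x \<in> V" "J (z - D x) = x" by blast
    then show ?thesis using J(2)[of "z - D x"] by (intro bexI[of _ x]) auto
  qed
  then show ?thesis by (metis (no_types, lifting) UNIV_eq_I imageI)
qed

section \<open>Homotopy invariance of index zero\<close>

lemma bounded_below_perturbation:
  assumes bb: "\<And>x. x \<in> V \<Longrightarrow> c * norm x \<le> norm (A x)"
    and d: "\<And>x. norm (D x) \<le> d * norm x" "d < c"
  shows "bounded_below_on V (\<lambda>x. A x + D x)"
  unfolding bounded_below_on_def
proof (intro exI[of _ "c - d"] conjI ballI)
  fix x assume "x \<in> V"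
  have "norm (A x) \<le> norm (A x + D x) + norm (D x)"
    by (metis add_diff_cancel_right' norm_triangle_ineq4)
  then show "(c - d) * norm x \<le> norm (A x + D x)"
    using bb[OF \<open>x \<in> V\<close>] d(1)[of x] by (simp add: left_diff_distrib)
qed (use d in simp)

text \<open>Openness: the same finite-rank correction \<open>R\<close> serves the perturbed operator
  as long as the perturbation stays below the lower bound of A + R.\<close>

lemma index_zero_perturbation:
  assumes A: "operator A" and ind: "index_zero A"
  shows "\<exists>\<delta>>0. \<forall>D d. operator D \<longrightarrow> (\<forall>x. norm (D x) \<le> d * norm x) \<longrightarrow> 0 \<le> d \<longrightarrow> d < \<delta> \<longrightarrow>
    index_zero (\<lambda>x. A x + D x)"
proof -
  obtain R where R: "finite_rank R" "bounded_below_on UNIV (\<lambda>x. A x + R x)" "surj (\<lambda>x. A x + R x)"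
    using ind by (auto simp: index_zero_def)
  obtain c where c: "c > 0" "\<And>x. c * norm x \<le> norm (A x + R x)"
    using R(2) by (auto simp: bounded_below_on_def)
  have AR: "operator (\<lambda>x. A x + R x)" by (rule operator_add[OF A finite_rank_operator[OF R(1)]])
  show ?thesis
  proof (intro exI[of _ c] conjI allI impI)
    fix D d assume D: "operator D" "\<forall>x. norm (D x) \<le> d * norm x" "0 \<le> d" "d < c"
    have "surj (\<lambda>x. (A x + R x) + D x)"
      using surj_perturbation[OF AR D(1) subspace_UNIV closed_UNIV c(2) R(3)] D by blast
    moreover have "bounded_below_on UNIV (\<lambda>x. (A x + R x) + D x)"
      using bounded_below_perturbation[where A="\<lambda>x. A x + R x"] c(2) D by blast
    ultimately show "index_zero (\<lambda>x. A x + D x)"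
      unfolding index_zero_def using R(1) by (intro exI[of _ R]) (simp add: ac_simps)
  qed (fact c)
qed

text \<open>Closedness. In the first case of the dichotomy, the nearby operator S + D is injective,
  hence onto by the Fredholm alternative, and removing D again keeps it onto. The second case
  contradicts index zero of the nearby operator.\<close>

lemma semi_fredholm_limit_index_zero:
  assumes A: "operator A" and sf: "semi_fredholm A"
  shows "\<exists>\<delta>>0. \<forall>D d. operator D \<longrightarrow> (\<forall>x. norm (D x) \<le> d * norm x) \<longrightarrow> 0 \<le> d \<longrightarrow> d < \<delta> \<longrightarrow>
    index_zero (\<lambda>x. A x + D x) \<longrightarrow> index_zero A"
proof -
  obtain R where R: "finite_rank R" and dich: "bounded_below_on UNIV (\<lambda>x. A x + R x) \<or>
    (\<exists>G. (\<forall>g\<in>G. functional g) \<and> joint_kernel G \<noteq> UNIV \<and>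
      bounded_below_on (joint_kernel G) (\<lambda>x. A x + R x) \<and>
      (\<lambda>x. A x + R x) ` joint_kernel G = UNIV)"
    using semi_fredholm_dichotomy[OF assms] by blast
  define S where "S = (\<lambda>x. A x + R x)"
  have S: "operator S" unfolding S_def by (rule operator_add[OF A finite_rank_operator[OF R]])
  have SD: "index_zero (\<lambda>x. S x + D x)" if "index_zero (\<lambda>x. A x + D x)" for D
    using index_zero_add_finite_rank[OF that R] by (simp add: S_def ac_simps)
  from dich show ?thesis
  proof
    assume "bounded_below_on UNIV (\<lambda>x. A x + R x)"
    then obtain c where c: "c > 0" "\<And>x. c * norm x \<le> norm (S x)"
      by (auto simp: bounded_below_on_def S_def)
    show ?thesis
    \<comment> \<open>S + D has lower bound c - d; the radius c/2 gives d < c - d, so that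
      subtracting D is again a small perturbation.\<close>
    proof (intro exI[of _ "c/2"] conjI allI impI)
      fix D d assume D: "operator D" "\<forall>x. norm (D x) \<le> d * norm x" "0 \<le> d" "d < c/2"
        and ind: "index_zero (\<lambda>x. A x + D x)"
      have SDop: "operator (\<lambda>x. S x + D x)" by (rule operator_add[OF S D(1)])
      have low: "(c - d) * norm x \<le> norm (S x + D x)" for x
      proof -
        have "norm (S x) \<le> norm (S x + D x) + norm (D x)"
          by (metis add_diff_cancel_right' norm_triangle_ineq4)
        then show ?thesis using c(2)[of x] D(2)[rule_format, of x] by (simp add: left_diff_distrib)
      qed
      have "inj (\<lambda>x. S x + D x)"
      proof (rule injI)
        fix x y assume "S x + D x = S y + D y"
        then have "S (x - y) + D (x - y) = 0" by (simp add: op_diff[OF S] op_diff[OF D(1)] algebra_simps)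
        then have "(c - d) * norm (x - y) \<le> 0" using low[of "x - y"] by simp
        then show "x = y" using D(4) c(1) by (simp add: mult_le_0_iff)
      qed
      then have "surj (\<lambda>x. S x + D x)" using fredholm_alternative[OF SDop SD[OF ind]] by simp
      moreover have "operator (\<lambda>x. - D x)"
        using operator_scaleR[OF D(1), of "-1"] by simp
      ultimately have "surj (\<lambda>x. (S x + D x) + - D x)"
        using surj_perturbation[OF SDop _ subspace_UNIV closed_UNIV low, of "\<lambda>x. - D x" d] D by auto
      then have "surj S" by simp
      moreover have "bounded_below_on UNIV S" using c by (auto simp: bounded_below_on_def)
      ultimately show "index_zero A" using R by (auto simp: index_zero_def S_def)
    qed (use c in simp)
  next
    assume "\<exists>G. (\<forall>g\<in>G. functional g) \<and> joint_kernel G \<noteq> UNIV \<and>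
      bounded_below_on (joint_kernel G) (\<lambda>x. A x + R x) \<and>
      (\<lambda>x. A x + R x) ` joint_kernel G = UNIV"
    then obtain G where G: "\<And>g. g \<in> G \<Longrightarrow> functional g" "joint_kernel G \<noteq> UNIV"
      "bounded_below_on (joint_kernel G) S" "S ` joint_kernel G = UNIV" by (auto simp: S_def)
    obtain c where c: "c > 0" "\<And>x. x \<in> joint_kernel G \<Longrightarrow> c * norm x \<le> norm (S x)"
      using G(3) by (auto simp: bounded_below_on_def)
    show ?thesis
    proof (intro exI[of _ c] conjI allI impI)
      fix D d assume D: "operator D" "\<forall>x. norm (D x) \<le> d * norm x" "0 \<le> d" "d < c"
        and ind: "index_zero (\<lambda>x. A x + D x)"
      have SDop: "operator (\<lambda>x. S x + D x)" by (rule operator_add[OF S D(1)])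
      have onto: "(\<lambda>x. S x + D x) ` joint_kernel G = UNIV"
        using surj_perturbation[OF S D(1) _ _ c(2) G(4)] joint_kernel_subspace[of G] G(1) D by blast
      \<comment> \<open>Already the proper subspace is mapped onto everything, so a vector outside
        it shares its image with one inside, against injectivity.\<close>
      then have "inj (\<lambda>x. S x + D x)"
        using fredholm_alternative[OF SDop SD[OF ind]] by auto
      moreover obtain e where "e \<notin> joint_kernel G" using G(2) by blast
      moreover obtain y where "y \<in> joint_kernel G" "S e + D e = S y + D y" using onto by blast
      ultimately show "index_zero A" by (auto dest: injD)
    qed (fact c)
  qed
qed

text \<open>Openness and closedness make index zero locally constant along the path; the interval is
  connected and the path starts at the identity.\<close>

lemma index_zero_homotopy:
  assumes K: "operator K" and sf: "\<And>t. 0 \<le> t \<Longrightarrow> t \<le> 1 \<Longrightarrow> semi_fredholm (\<lambda>x. x - t *\<^sub>R K x)"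
    and t: "0 \<le> t" "t \<le> 1"
  shows "index_zero (\<lambda>x. x - t *\<^sub>R K x)"
proof -
  define A where "A t = (\<lambda>x. x - t *\<^sub>R K x)" for t :: real
  have A: "operator (A t)" for t
    unfolding A_def by (rule operator_diff[OF operator_ident operator_scaleR[OF K]])
  obtain k where k: "k > 0" "\<And>x. norm (K x) \<le> k * norm x"
    using bounded_linear.pos_bounded[OF operator_bounded_linear[OF K]] by (auto simp: mult.commute)
  define D where "D s = (\<lambda>x. s *\<^sub>R K x)" for s :: real
  have D: "operator (D s)" "norm (D s x) \<le> (\<bar>s\<bar> * k) * norm x" for s x
    unfolding D_def using operator_scaleR[OF K] k(2)[of x] by (auto simp: mult_left_mono mult.assoc)
  have AD: "A t = (\<lambda>x. A u x + D (u - t) x)" for t u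
    by (auto simp: A_def D_def scaleR_left_diff_distrib)
  have near: "\<exists>r>0. \<forall>t. \<bar>t - u\<bar> < r \<longrightarrow> (index_zero (A t) \<longleftrightarrow> index_zero (A u))"
    if u: "u \<in> {0..1}" for u
  proof -
    have "semi_fredholm (A u)" using u sf by (simp add: A_def)
    from semi_fredholm_limit_index_zero[OF A this] obtain \<delta>1 where \<delta>1: "\<delta>1 > 0"
      "\<And>E d. operator E \<Longrightarrow> \<forall>x. norm (E x) \<le> d * norm x \<Longrightarrow> 0 \<le> d \<Longrightarrow> d < \<delta>1 \<Longrightarrow>
        index_zero (\<lambda>x. A u x + E x) \<Longrightarrow> index_zero (A u)" by blast
    \<comment> \<open>The premise is inside the quantifier so that a radius exists also when
      \<open>A u\<close> is not yet known to have index zero.\<close>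
    have "\<exists>\<delta>2>0. index_zero (A u) \<longrightarrow> (\<forall>E d. operator E \<longrightarrow> (\<forall>x. norm (E x) \<le> d * norm x) \<longrightarrow> 0 \<le> d \<longrightarrow> d < \<delta>2 \<longrightarrow>
        index_zero (\<lambda>x. A u x + E x))"
      using index_zero_perturbation[OF A] zero_less_one by metis
    then obtain \<delta>2 where \<delta>2: "\<delta>2 > 0"
      "\<And>E d. index_zero (A u) \<Longrightarrow> operator E \<Longrightarrow> \<forall>x. norm (E x) \<le> d * norm x \<Longrightarrow> 0 \<le> d \<Longrightarrow> d < \<delta>2 \<Longrightarrow>
        index_zero (\<lambda>x. A u x + E x)" by blast
    show ?thesis
    \<comment> \<open>A t and A u differ by a multiple of \<open>K\<close> of norm at most
      \<open>k\<close> times the distance of t and u.\<close>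
    proof (intro exI[of _ "min \<delta>1 \<delta>2 / k"] conjI allI impI)
      show "0 < min \<delta>1 \<delta>2 / k" using \<delta>1(1) \<delta>2(1) k(1) by simp
      fix t assume "\<bar>t - u\<bar> < min \<delta>1 \<delta>2 / k"
      then have "\<bar>u - t\<bar> * k < \<delta>1" "\<bar>u - t\<bar> * k < \<delta>2"
        using k(1) by (simp_all add: field_simps abs_minus_commute)
      then show "index_zero (A t) \<longleftrightarrow> index_zero (A u)"
        using \<delta>1(2)[of "D (u - t)" "\<bar>u - t\<bar> * k"] \<delta>2(2)[of "D (u - t)" "\<bar>u - t\<bar> * k"] D k(1) AD[of t u]
        by auto
    qed
  qed
  have "index_zero (A t)"
  proof (rule connected_induction_simple[where P="\<lambda>t. index_zero (A t)" and S="{0..1::real}" and a=0])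
    have "finite_rank (\<lambda>x. 0)" by (rule finite_rank.zero)
    then show "index_zero (A 0)" unfolding index_zero_def bounded_below_on_def
      by (intro exI[of _ "\<lambda>x. 0"]) (auto simp: A_def intro!: exI[of _ "1::real"])
    fix u :: real assume u: "u \<in> {0..1}"
    obtain r where r: "r > 0" "\<And>t. \<bar>t - u\<bar> < r \<Longrightarrow> (index_zero (A t) \<longleftrightarrow> index_zero (A u))"
      using near[OF u] by blast
    show "\<exists>T. openin (top_of_set {0..1}) T \<and> u \<in> T \<and>
        (\<forall>x\<in>T. \<forall>y\<in>T. index_zero (A x) \<longrightarrow> index_zero (A y))"
    proof (intro exI[of _ "{0..1} \<inter> ball u r"] conjI ballI impI)
      fix x y assume "x \<in> {0..1} \<inter> ball u r" "y \<in> {0..1} \<inter> ball u r" "index_zero (A x)"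
      then show "index_zero (A y)" using r(2)[of x] r(2)[of y]
        by (simp add: dist_real_def abs_minus_commute)
    qed (use u r in \<open>auto simp: openin_open\<close>)
  qed (use t in auto)
  then show ?thesis by (simp add: A_def)
qed

section \<open>Subspaces on which an operator is small\<close>

lemma closure_subspace:
  assumes V: "subspace V" shows "subspace (closure V)"
proof (rule subspaceI)
  show "0 \<in> closure V" using subspace_0[OF V] closure_subset by blast
next
  fix x y assume "x \<in> closure V" "y \<in> closure V"
  then obtain u v where "\<forall>n. u n \<in> V" "u \<longlonglongrightarrow> x" "\<forall>n. v n \<in> V" "v \<longlonglongrightarrow> y"
    by (auto simp: closure_sequential)
  then show "x + y \<in> closure V" unfolding closure_sequential
    by (intro exI[of _ "\<lambda>n. u n + v n"]) (auto intro: tendsto_add subspace_add[OF V])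
next
  fix c x assume "x \<in> closure V"
  then obtain u where "\<forall>n. u n \<in> V" "u \<longlonglongrightarrow> x" by (auto simp: closure_sequential)
  then show "smul c x \<in> closure V" unfolding closure_sequential
    by (intro exI[of _ "\<lambda>n. smul c (u n)"])
      (auto intro: bounded_linear.tendsto[OF bounded_linear_smul] subspace_scale[OF V])
qed

text \<open>T has no lower bound on any joint kernel of finitely many functionals, so the next unit
  vector can be taken in the kernels of all earlier functionals with T almost zero on it. Its
  functional is corrected to vanish at the earlier vectors. The bound \<open>K n\<close> is fixed in
  advance, so the vector can be chosen small relative to a functional that is built only
  afterwards.\<close>

lemma biorthogonal_sequence:
  assumes T: "operator T" and not_sf: "\<not> semi_fredholm T" and C: "C > 0"
    and sep: "\<And>x. norm x = 1 \<Longrightarrow> \<exists>f. functional f \<and> f x = 1 \<and> (\<forall>z. norm (f z) \<le> C * norm z)"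
  obtains x f K where "\<And>n::nat. functional (f n)" "\<And>n m. f n (x m) = (if n = m then 1 else 0)"
    "\<And>n z. norm (f n z) \<le> K n * norm z" "\<And>n. norm (T (x n)) * K n \<le> (1/2)^(n+2)"
proof -
  \<comment> \<open>Solves the recursion \<open>K_sum\<close>: \<open>C\<close> for the raw
    functional plus C K m for the correction at each earlier m.\<close>
  define K where "K n = C * (1 + C)^n" for n :: nat
  have K: "K n > 0" for n using C by (simp add: K_def)
  have K_sum: "C + C * (\<Sum>m<n. K m) = K n" for n
    by (induction n) (simp_all add: K_def algebra_simps)
  \<comment> \<open>A stage \<open>r\<close> is a pair of a vector and its functional;
    \<open>h\<close> holds the earlier stages.\<close>
  define P where "P h n r \<longleftrightarrow> norm (fst r) = 1 \<and> functional (snd r) \<and> snd r (fst r) = 1 \<and>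
      (\<forall>z. norm (snd r z) \<le> K n * norm z) \<and> norm (T (fst r)) * K n \<le> (1/2)^(n+2) \<and>
      (\<forall>m<n. snd (h m) (fst r) = 0 \<and> snd r (fst (h m)) = 0)"
    for h :: "nat \<Rightarrow> 'a \<times> ('a \<Rightarrow> 'k)" and n r
  have "\<exists>h. \<forall>n. P h n (h n)"
  proof (rule dependent_wellorder_choice)
    show "P h n r = P g n r" if "\<And>m. m < n \<Longrightarrow> h m = g m" for h g n r
      using that by (auto simp: P_def)
    fix n h assume h: "\<And>m. m < n \<Longrightarrow> P h m (h m)"
    define G where "G = (\<lambda>m. snd (h m)) ` {..<n}"
    have G: "finite G" "\<forall>g\<in>G. functional g" using h by (auto simp: G_def P_def)
    define \<epsilon> where "\<epsilon> = (1/2)^(n+2) / K n"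
    have \<epsilon>: "\<epsilon> > 0" using K by (simp add: \<epsilon>_def)
    have "\<not> bounded_below_on (joint_kernel G) T" using not_sf G unfolding semi_fredholm_def by blast
    then obtain x0 where x0: "x0 \<in> joint_kernel G" "norm (T x0) < \<epsilon> * norm x0"
      using \<epsilon> unfolding bounded_below_on_def by (meson not_le)
    then have nz: "x0 \<noteq> 0" by (auto simp: op_zero[OF T])
    define x where "x = smul (of_real (1 / norm x0)) x0"
    have x: "x \<in> joint_kernel G" unfolding x_def
      using joint_kernel_subspace(2)[of G] G(2) x0(1) subspace_scale by blast
    have nx: "norm x = 1" using nz by (simp add: x_def norm_smul norm_divide)
    have "norm (T x) = norm (T x0) / norm x0"
      by (simp add: x_def op_smul[OF T] norm_smul norm_divide)
    then have "norm (T x) \<le> \<epsilon>" using x0(2) nz by (simp add: pos_divide_le_eq)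
    then have Tx: "norm (T x) * K n \<le> (1/2)^(n+2)" using K[of n] by (simp add: \<epsilon>_def field_simps)
    obtain f where f: "functional f" "f x = 1" "\<And>z. norm (f z) \<le> C * norm z" using sep[OF nx] by blast
    \<comment> \<open>Gram-Schmidt for functionals. The correction does not disturb the value at
      \<open>x\<close>, since \<open>x\<close> lies in the kernels of the earlier
      functionals.\<close>
    define f' where "f' z = f z - (\<Sum>m<n. f (fst (h m)) * snd (h m) z)" for z
    have "functional f'" unfolding f'_def
      using f(1) h by (intro functional_diff functional_sum functional_mult) (auto simp: P_def)
    moreover have hx: "snd (h m) x = 0" if "m < n" for m
      using x that by (auto simp: joint_kernel_def G_def)
    then have "f' x = 1" using f(2) by (simp add: f'_def)
    moreover have "f' (fst (h j)) = 0" if j: "j < n" for j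
    proof -
      have "snd (h m) (fst (h j)) = (if m = j then 1 else 0)" if m: "m < n" for m
        using h[OF m] h[OF j] by (cases m j rule: linorder_cases) (auto simp: P_def)
      then have "(\<Sum>m<n. f (fst (h m)) * snd (h m) (fst (h j))) =
          (\<Sum>m<n. if m = j then f (fst (h m)) else 0)"
        by (intro sum.cong) auto
      then show ?thesis using j by (simp add: f'_def)
    qed
    moreover have "norm (f' z) \<le> K n * norm z" for z
    proof -
      have "norm (f (fst (h m)) * snd (h m) z) \<le> C * (K m * norm z)" if m: "m < n" for m
        unfolding norm_mult
        using h[OF m] f(3)[of "fst (h m)"] C by (intro mult_mono) (auto simp: P_def)
      then have "norm (\<Sum>m<n. f (fst (h m)) * snd (h m) z) \<le> (\<Sum>m<n. C * (K m * norm z))"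
        by (intro sum_norm_le) auto
      also have "\<dots> = C * (\<Sum>m<n. K m) * norm z"
        by (simp add: sum_distrib_left sum_distrib_right mult.assoc)
      finally have "norm (f z) + norm (\<Sum>m<n. f (fst (h m)) * snd (h m) z) \<le>
          C * norm z + C * (\<Sum>m<n. K m) * norm z"
        using f(3)[of z] by linarith
      then have "norm (f' z) \<le> C * norm z + C * (\<Sum>m<n. K m) * norm z"
        unfolding f'_def by (rule order_trans[OF norm_triangle_ineq4])
      then show ?thesis unfolding distrib_right[symmetric] K_sum .
    qed
    ultimately have "P h n (x, f')" using nx Tx hx by (simp add: P_def)
    then show "\<exists>r. P h n r" ..
  qed
  then obtain h where h: "\<And>n. P h n (h n)" by blast
  show ?thesis
  proof (rule that[of "\<lambda>n. snd (h n)" "\<lambda>n. fst (h n)" K])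
    show "snd (h n) (fst (h m)) = (if n = m then 1 else 0)" for n m
      using h[of n] h[of m] by (cases n m rule: linorder_cases) (auto simp: P_def)
  qed (use h in \<open>auto simp: P_def\<close>)
qed

text \<open>On the span of the biorthogonal vectors, z is the finite sum of f i z times x i, and the
  bounds on T (x i) sum to a geometric series below 1/2. The estimate is closed, so it holds on the
  closure.\<close>

lemma not_semi_fredholm_small_on_subspace:
  assumes T: "operator T" and not_sf: "\<not> semi_fredholm T" and C: "C > 0"
    and sep: "\<And>x. norm x = 1 \<Longrightarrow> \<exists>f. functional f \<and> f x = 1 \<and> (\<forall>z. norm (f z) \<le> C * norm z)"
  obtains M where "subspace M" "closed M" "infinite_dimensional smul M"
    "\<And>x. x \<in> M \<Longrightarrow> norm (T x) \<le> 1/2 * norm x"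
proof -
  obtain x f K where f: "\<And>n::nat. functional (f n)" and fx: "\<And>n m. f n (x m) = (if n = m then 1 else 0)"
    and fK: "\<And>n z. norm (f n z) \<le> K n * norm z" and TK: "\<And>n. norm (T (x n)) * K n \<le> (1/2)^(n+2)"
    by (rule biorthogonal_sequence[OF T not_sf C sep]) (assumption, rule that)
  define M where "M = closure (span (range x))"
  have small: "norm (T z) \<le> 1/2 * norm z" if "z \<in> span (range x)" for z
  proof -
    \<comment> \<open>The expansion is required for all large lengths so that two vectors with
      expansions of different length can be added.\<close>
    define E where "E z \<longleftrightarrow> (\<exists>N. \<forall>n\<ge>N. z = (\<Sum>i<n. smul (f i z) (x i)))" for z
    have "E z" using that
    proof (induction rule: span_induct_alt)
      case base
      show ?case by (simp add: E_def fn_zero[OF f])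
    next
      case (step c y z)
      then obtain m N where y: "y = x m" and N: "\<And>n. n \<ge> N \<Longrightarrow> z = (\<Sum>i<n. smul (f i z) (x i))"
        by (auto simp: E_def)
      have "smul c y + z = (\<Sum>i<n. smul (f i (smul c y + z)) (x i))" if n: "n \<ge> max (Suc m) N" for n
      proof -
        have "(\<Sum>i<n. smul (f i (smul c y + z)) (x i)) =
            (\<Sum>i<n. if i = m then smul c (x i) else 0) + (\<Sum>i<n. smul (f i z) (x i))"
          unfolding sum.distrib[symmetric]
          by (intro sum.cong) (auto simp: fn_add[OF f] fn_smul[OF f] y fx scale_left_distrib)
        then show ?thesis using n N[of n] by (simp add: y)
      qed
      then show ?case unfolding E_def by blast
    qed
    then obtain N where z: "z = (\<Sum>i<N. smul (f i z) (x i))" by (auto simp: E_def)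
    have "T z = (\<Sum>i<N. smul (f i z) (T (x i)))"
      by (subst z) (simp add: linear_sum[OF bounded_linear.linear[OF operator_bounded_linear[OF T]]] op_smul[OF T])
    also have "norm \<dots> \<le> (\<Sum>i<N. (1/2)^(i+2) * norm z)"
    proof (rule sum_norm_le)
      fix i
      have "norm (smul (f i z) (T (x i))) \<le> K i * norm z * norm (T (x i))"
        unfolding norm_smul by (intro mult_right_mono fK) auto
      also have "\<dots> \<le> (1/2)^(i+2) * norm z"
        using mult_right_mono[OF TK[of i], of "norm z"] by (simp add: mult_ac)
      finally show "norm (smul (f i z) (T (x i))) \<le> (1/2)^(i+2) * norm z" .
    qed
    also have "\<dots> = (\<Sum>i<N. (1/2)^(i+2)) * norm z" by (simp add: sum_distrib_right)
    also have "\<dots> \<le> 1/2 * norm z"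
    proof (rule mult_right_mono)
      have "(\<Sum>i<N. (1/2)^(i+2)) = 1/2 - (1/2::real)^(N+1)" by (induction N) auto
      then show "(\<Sum>i<N. (1/2::real)^(i+2)) \<le> 1/2" by simp
    qed simp
    finally show ?thesis .
  qed
  show ?thesis
  proof (rule that[of M])
    show "subspace M" unfolding M_def by (intro closure_subspace subspace_span)
    show "closed M" by (simp add: M_def)
    have "closed {z. norm (T z) \<le> 1/2 * norm z}"
      by (intro closed_Collect_le continuous_intros linear_continuous_on operator_bounded_linear T)
    then have "M \<subseteq> {z. norm (T z) \<le> 1/2 * norm z}"
      unfolding M_def by (intro closure_minimal) (use small in auto)
    then show "norm (T z) \<le> 1/2 * norm z" if "z \<in> M" for z using that by auto
    have "inj x" by (rule injI) (metis fx zero_neq_one)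
    have "independent (range x)"
      unfolding dependent_def
    proof safe
      fix n assume "x n \<in> span (range x - {x n})"
      then have "f n (x n) = 0"
      proof (rule span_induct)
        show "subspace {z. f n z = 0}"
          by (intro subspaceI) (auto simp: fn_zero[OF f] fn_add[OF f] fn_smul[OF f])
        show "\<And>z. z \<in> range x - {x n} \<Longrightarrow> f n z = 0" using fx by auto
      qed
      then show False by (simp add: fx)
    qed
    moreover have "range x \<subseteq> M" unfolding M_def
      using span_superset closure_subset by (metis order_trans)
    moreover have "infinite (range x)" using \<open>inj x\<close> by (simp add: finite_image_iff)
    ultimately show "infinite_dimensional smul M"
      unfolding infinite_dimensional_def using independent_span_bound by metis
  qed
qed

section \<open>Isomorphisms and duals of subspaces\<close>

lemma normed_subspace_simps [simp]:
  "points (normed_subspace smul V) = V" "scl (normed_subspace smul V) = smul"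
  "nrm (normed_subspace smul V) = norm"
  by (simp_all add: normed_subspace_def)

lemma isomorphismI:
  assumes T: "bounded_operator (normed_subspace smul V) Z T" and V: "subspace V"
    and onto: "T ` V = points Z" and c: "c > 0" "\<And>x. x \<in> V \<Longrightarrow> c * norm x \<le> nrm Z (T x)"
  shows "isomorphism (normed_subspace smul V) Z T"
proof -
  have add: "T (x + y) = T x + T y" if "x \<in> V" "y \<in> V" for x y
    using T that by (simp add: bounded_operator_def)
  have scale: "T (smul k x) = scl Z k (T x)" if "x \<in> V" for x k
    using T that by (simp add: bounded_operator_def)
  have T0: "T 0 = 0" using add[of 0 0] subspace_0[OF V] by simp
  obtain K where "\<And>x. x \<in> V \<Longrightarrow> nrm Z (T x) \<le> K * norm x"
    using T by (simp add: bounded_operator_def) meson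
  \<comment> \<open>\<open>nrm Z\<close> is an arbitrary function, not known to be a norm; what
    injectivity needs about it at 0 is drawn from the boundedness of T.\<close>
  from this[of 0] have N0: "nrm Z 0 \<le> 0" using subspace_0[OF V] T0 by simp
  have inj: "inj_on T V"
  proof (rule inj_onI)
    fix x y assume xy: "x \<in> V" "y \<in> V" "T x = T y"
    then have d: "x - y \<in> V" using V subspace_diff by blast
    have "T (x - y) = 0" using add[OF d xy(2)] xy(3) by simp
    then have "c * norm (x - y) \<le> 0" using c(2)[OF d] N0 by simp
    then show "x = y" using c(1) by (simp add: mult_le_0_iff)
  qed
  have inv: "inv_into V T z \<in> V" "T (inv_into V T z) = z" if "z \<in> points Z" for z
    using that onto[symmetric] by (simp_all add: inv_into_into f_inv_into_f)
  have inv_eq: "inv_into V T z = x" if "x \<in> V" "T x = z" for x z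
    using that inj by (auto simp: inv_into_f_f)
  have "bounded_operator Z (normed_subspace smul V) (inv_into V T)"
    unfolding bounded_operator_def normed_subspace_simps
  proof (intro conjI ballI allI exI[of _ "1/c"])
    show "inv_into V T (z + w) = inv_into V T z + inv_into V T w"
      if "z \<in> points Z" "w \<in> points Z" for z w
      using inv[OF that(1)] inv[OF that(2)] by (intro inv_eq) (auto simp: add intro: subspace_add[OF V])
    show "inv_into V T (scl Z k z) = smul k (inv_into V T z)" if "z \<in> points Z" for z k
      using inv[OF that] by (intro inv_eq) (auto simp: scale intro: subspace_scale[OF V])
    show "norm (inv_into V T z) \<le> 1/c * nrm Z z" if "z \<in> points Z" for z
      using c(2)[OF inv(1)[OF that]] inv[OF that] c(1) by (simp add: field_simps)
  qed (use inv in auto)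
  then show ?thesis using T inj onto by (simp add: isomorphism_def bij_betw_def)
qed

lemma dual_norm_upper:
  assumes f: "f \<in> points (dual cj (normed_subspace smul V))" and x: "x \<in> V" "norm x \<le> 1"
  shows "norm (f x) \<le> nrm (dual cj (normed_subspace smul V)) f"
proof -
  obtain K where K: "\<And>x. x \<in> V \<Longrightarrow> norm (f x) \<le> K * norm x"
    using f by (simp add: dual_def) meson
  have "bdd_above ((\<lambda>x. norm (f x)) ` {x \<in> V. norm x \<le> 1})"
  proof (rule bdd_aboveI2)
    fix x assume "x \<in> {x \<in> V. norm x \<le> 1}"
    then have x: "x \<in> V" "norm x \<le> 1" by auto
    have "K * norm x \<le> \<bar>K\<bar> * 1" using x(2) by (intro mult_mono) auto
    then show "norm (f x) \<le> \<bar>K\<bar>" using K[OF x(1)] by simp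
  qed
  then show ?thesis unfolding dual_def using x by (auto intro: cSUP_upper)
qed

lemma dual_norm_nonneg:
  assumes "subspace V" "f \<in> points (dual cj (normed_subspace smul V))"
  shows "0 \<le> nrm (dual cj (normed_subspace smul V)) f"
  using dual_norm_upper[OF assms(2) subspace_0[OF assms(1)]] norm_ge_zero[of "f 0"]
  by (simp del: norm_ge_zero)

lemma dual_norm_le:
  assumes V: "subspace V" and cj: "\<And>a. norm (cj a) = norm a"
    and f: "f \<in> points (dual cj (normed_subspace smul V))" and x: "x \<in> V"
  shows "norm (f x) \<le> nrm (dual cj (normed_subspace smul V)) f * norm x"
proof (cases "x = 0")
  case True
  have "f (0 + 0) = f 0 + f 0"
    using f subspace_0[OF V] unfolding dual_def by (simp del: add_0 add_0_right)
  then show ?thesis using True by simp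
next
  case False
  define u where "u = smul (of_real (1 / norm x)) x"
  have u: "u \<in> V" "norm u \<le> 1"
    using x False V by (auto simp: u_def norm_smul norm_divide intro: subspace_scale)
  have "f u = cj (of_real (1 / norm x)) * f x" using f x unfolding u_def dual_def by simp
  then have "norm (f u) = norm (f x) / norm x" by (simp add: norm_mult cj norm_divide)
  then show ?thesis using dual_norm_upper[OF f u] False by (simp add: pos_divide_le_eq)
qed

lemma dual_norm_leI:
  assumes V: "subspace V" and m: "0 \<le> m" "\<And>x. x \<in> V \<Longrightarrow> norm (f x) \<le> m * norm x"
  shows "nrm (dual cj (normed_subspace smul V)) f \<le> m"
proof -
  have "norm (f x) \<le> m" if "x \<in> V" "norm x \<le> 1" for x
    using m(2)[OF that(1)] mult_left_mono[OF that(2) m(1)] by simp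
  moreover have "{x \<in> V. norm x \<le> 1} \<noteq> {}" using subspace_0[OF V] by force
  ultimately show ?thesis unfolding dual_def by (auto intro!: cSUP_least)
qed

end

section \<open>Almost symplectic structures\<close>

text \<open>\<open>cj\<close> abstracts \<open>id\<close> and \<open>cnj\<close> as an isometric
  involution of the field that fixes the reals. Read as a form, \<alpha> x y is linear in x and
  \<open>cj\<close>-linear in y, which covers the bilinear and the sesquilinear case.\<close>

locale almost_symplectic_space = scalar_banach smul
  for smul :: "'k::real_normed_field \<Rightarrow> 'a::banach \<Rightarrow> 'a" +
  fixes cj :: "'k \<Rightarrow> 'k" and \<alpha> :: "'a \<Rightarrow> 'a \<Rightarrow> 'k"
  assumes cj_add: "cj (a + b) = cj a + cj b" and cj_mult: "cj (a * b) = cj a * cj b"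
    and cj_cj [simp]: "cj (cj a) = a" and norm_cj [simp]: "norm (cj a) = norm a"
    and cj_of_real [simp]: "cj (of_real r) = of_real r"
    and iso: "isomorphism (normed_subspace smul UNIV) (dual cj (normed_subspace smul UNIV)) \<alpha>"
    and strict: "strictly_singular smul (dual cj (normed_subspace smul UNIV))
      (\<lambda>x. \<alpha> x + adjoint_on cj (normed_subspace smul UNIV) \<alpha> x)"
begin

abbreviation D :: "('k, 'a \<Rightarrow> 'k) normed_space"
  where "D \<equiv> dual cj (normed_subspace smul UNIV)"

lemma cj_0 [simp]: "cj 0 = 0" using cj_of_real[of 0] by simp
lemma cj_1 [simp]: "cj 1 = 1" using cj_of_real[of 1] by simp
lemma cj_minus: "cj (- a) = - cj a" using cj_add[of a "- a"] by (simp add: eq_neg_iff_add_eq_0 add.commute)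
lemma cj_diff: "cj (a - b) = cj a - cj b" using cj_add[of a "- b"] by (simp add: cj_minus)
lemma cj_eq_0 [simp]: "cj a = 0 \<longleftrightarrow> a = 0" by (metis cj_0 cj_cj)

text \<open>Conjugating the values turns elements of the conjugate dual into ordinary functionals,
  to which the operator theory above applies.\<close>

definition conj_functional :: "('a \<Rightarrow> 'k) \<Rightarrow> bool"
  where "conj_functional g \<longleftrightarrow> functional (\<lambda>x. cj (g x))"

lemma points_D: "points D = {g. conj_functional g}"
proof (intro set_eqI iffI CollectI)
  fix g assume g: "g \<in> points D"
  then obtain K where K: "\<And>x. norm (g x) \<le> K * norm x" by (simp add: dual_def) meson
  show "conj_functional g" unfolding conj_functional_def
    using g by (intro functionalI[where K=K]) (simp_all add: dual_def cj_add cj_mult K)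
next
  fix g assume "g \<in> {g. conj_functional g}"
  then have f: "functional (\<lambda>x. cj (g x))" by (simp add: conj_functional_def)
  then obtain K where K: "\<And>x. norm (cj (g x)) \<le> K * norm x" by (rule functional_bound) blast
  have "g (x + y) = g x + g y" for x y using arg_cong[OF fn_add[OF f, of x y], of cj] by (simp add: cj_add)
  moreover have "g (smul c x) = cj c * g x" for c x
    using arg_cong[OF fn_smul[OF f, of c x], of cj] by (simp add: cj_mult)
  ultimately show "g \<in> points D" using K by (auto simp: dual_def)
qed

lemma conj_functional_cj: "functional f \<Longrightarrow> conj_functional (\<lambda>x. cj (f x))"
  by (simp add: conj_functional_def)

lemma conj_functional_form: "conj_functional (\<alpha> x)"
  using iso points_D by (auto simp: isomorphism_def bounded_operator_def)

lemma form_right_functional: "functional (\<lambda>y. cj (\<alpha> x y))"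
  using conj_functional_form by (simp add: conj_functional_def)

lemma form_right_add: "\<alpha> x (y + z) = \<alpha> x y + \<alpha> x z"
  using arg_cong[OF fn_add[OF form_right_functional, of x y z], of cj] by (simp add: cj_add)

lemma form_right_diff: "\<alpha> x (y - z) = \<alpha> x y - \<alpha> x z"
  using arg_cong[OF fn_diff[OF form_right_functional, of x y z], of cj] by (simp add: cj_diff)

lemma form_right_smul: "\<alpha> x (smul c y) = cj c * \<alpha> x y"
  using arg_cong[OF fn_smul[OF form_right_functional, of x c y], of cj] by (simp add: cj_mult)

lemma form_left_add: "\<alpha> (x + y) z = \<alpha> x z + \<alpha> y z"
  using iso by (simp add: isomorphism_def bounded_operator_def)

lemma form_left_smul: "\<alpha> (smul c x) z = c * \<alpha> x z"
  using iso by (simp add: isomorphism_def bounded_operator_def dual_def)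

lemma form_left_diff: "\<alpha> (x - y) z = \<alpha> x z - \<alpha> y z"
  using form_left_add[of "x - y" y z] by simp

lemma form_zero [simp]: "\<alpha> 0 z = 0" "\<alpha> x 0 = 0"
  using form_left_diff[of 0 0 z] form_right_diff[of x 0 0] by simp_all

lemma form_bounded: obtains L where "L > 0" "\<And>x y. norm (\<alpha> x y) \<le> L * norm x * norm y"
proof -
  obtain L where L: "\<And>x. nrm D (\<alpha> x) \<le> L * norm x"
    using iso by (simp add: isomorphism_def bounded_operator_def) meson
  have "norm (\<alpha> x y) \<le> (\<bar>L\<bar> + 1) * norm x * norm y" for x y
  proof -
    have "norm (\<alpha> x y) \<le> nrm D (\<alpha> x) * norm y"
      using dual_norm_le[OF subspace_UNIV norm_cj] points_D conj_functional_form by auto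
    also have "\<dots> \<le> ((\<bar>L\<bar> + 1) * norm x) * norm y"
      by (intro mult_right_mono order_trans[OF L]) auto
    finally show ?thesis .
  qed
  then show ?thesis by (intro that[of "\<bar>L\<bar> + 1"]) auto
qed

lemma form_left_functional: "functional (\<lambda>x. \<alpha> x y)"
proof -
  obtain L where L: "L > 0" "\<And>x y. norm (\<alpha> x y) \<le> L * norm x * norm y" using form_bounded by blast
  show ?thesis
  proof (rule functionalI[where K="L * norm y"])
    show "norm (\<alpha> x y) \<le> L * norm y * norm x" for x using L(2)[of x y] by (simp add: mult_ac)
  qed (simp_all add: form_left_add form_left_smul)
qed

text \<open>The analogue of the Riesz representation: the vector that represents a conjugate-linear
  functional through the form.\<close>

definition rep :: "('a \<Rightarrow> 'k) \<Rightarrow> 'a"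
  where "rep = inv \<alpha>"

lemma form_rep: "conj_functional g \<Longrightarrow> \<alpha> (rep g) = g"
  using iso points_D unfolding isomorphism_def rep_def
  by (metis (no_types, lifting) bij_betw_imp_surj_on f_inv_into_f mem_Collect_eq normed_subspace_simps(1))

lemma form_eqI: "(\<And>y. \<alpha> x y = \<alpha> x' y) \<Longrightarrow> x = x'"
  using iso unfolding isomorphism_def bij_betw_def normed_subspace_simps by (metis ext injD)

lemma norm_le_dual_norm: obtains M where "M > 0" "\<And>x. norm x \<le> M * nrm D (\<alpha> x)"
proof -
  obtain K where K: "\<And>g. g \<in> points D \<Longrightarrow> norm (inv \<alpha> g) \<le> K * nrm D g"
    using iso by (simp add: isomorphism_def bounded_operator_def) meson
  have "norm x \<le> (\<bar>K\<bar> + 1) * nrm D (\<alpha> x)" for x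
  proof -
    have ax: "\<alpha> x \<in> points D" using points_D conj_functional_form by auto
    have "inv \<alpha> (\<alpha> x) = x" using iso by (simp add: isomorphism_def bij_betw_def)
    then have "norm x \<le> K * nrm D (\<alpha> x)" using K[OF ax] by simp
    also have "\<dots> \<le> (\<bar>K\<bar> + 1) * nrm D (\<alpha> x)"
      by (intro mult_right_mono dual_norm_nonneg subspace_UNIV ax) auto
    finally show ?thesis .
  qed
  then show ?thesis by (intro that[of "\<bar>K\<bar> + 1"]) auto
qed

lemma norm_le_of_form: obtains M where "M > 0"
  "\<And>x m. 0 \<le> m \<Longrightarrow> (\<And>y. norm (\<alpha> x y) \<le> m * norm y) \<Longrightarrow> norm x \<le> M * m"
proof -
  obtain M where M: "M > 0" "\<And>x. norm x \<le> M * nrm D (\<alpha> x)" using norm_le_dual_norm by blast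
  have "norm x \<le> M * m" if m: "0 \<le> m" "\<And>y. norm (\<alpha> x y) \<le> m * norm y" for x m
    by (rule order_trans[OF M(2) mult_left_mono[OF dual_norm_leI[OF subspace_UNIV m]]]) (use M(1) in auto)
  then show ?thesis using that M(1) by blast
qed

text \<open>The functionals \<open>z \<mapsto> \<alpha> z y\<close> separate points quantitatively, which replaces the
  Hahn-Banach theorem.\<close>

lemma separation:
  obtains C where "C > 0"
    "\<And>x. x \<noteq> 0 \<Longrightarrow> \<exists>f. functional f \<and> f x = 1 \<and> (\<forall>z. norm (f z) \<le> C / norm x * norm z)"
proof -
  obtain L where L: "L > 0" "\<And>x y. norm (\<alpha> x y) \<le> L * norm x * norm y" using form_bounded by blast
  obtain M where M: "M > 0"
    "\<And>x m. 0 \<le> m \<Longrightarrow> (\<And>y. norm (\<alpha> x y) \<le> m * norm y) \<Longrightarrow> norm x \<le> M * m"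
    using norm_le_of_form by blast
  show ?thesis
  proof (rule that[of "2 * M * L"])
    show "2 * M * L > 0" using L M by simp
    fix x :: 'a assume x: "x \<noteq> 0"
    \<comment> \<open>The factor 2 makes the estimate of \<open>norm_le_of_form\<close> fail for
      this m, which yields a y at which the form is large.\<close>
    have "\<not> norm x \<le> M * (norm x / (2 * M))" using M(1) x by simp
    then obtain y where y: "norm x / (2 * M) * norm y < norm (\<alpha> x y)"
      using M(2)[of "norm x / (2 * M)" x] M(1) by (metis divide_nonneg_pos mult_pos_pos norm_ge_zero not_le zero_less_numeral)
    moreover have "0 \<le> norm x / (2 * M) * norm y" using M(1) by simp
    ultimately have a: "\<alpha> x y \<noteq> 0" by auto
    have "norm (1 / \<alpha> x y * \<alpha> z y) \<le> 2 * M * L / norm x * norm z" for z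
    proof -
      have "norm (\<alpha> z y) * norm x \<le> L * norm z * norm y * norm x"
        using L(2) by (intro mult_right_mono) auto
      also have "\<dots> = 2 * M * L * norm z * (norm x / (2 * M) * norm y)" using M(1) by simp
      also have "\<dots> \<le> 2 * M * L * norm z * norm (\<alpha> x y)"
        using y L(1) M(1) by (intro mult_left_mono) auto
      finally show ?thesis using a x by (simp add: norm_mult norm_divide field_simps)
    qed
    then show "\<exists>f. functional f \<and> f x = 1 \<and> (\<forall>z. norm (f z) \<le> 2 * M * L / norm x * norm z)"
      using functional_mult[OF form_left_functional, of "1 / \<alpha> x y" y] a
      by (intro exI[of _ "\<lambda>z. 1 / \<alpha> x y * \<alpha> z y"]) simp
  qed
qed

lemma separating_functional:
  assumes "x \<noteq> 0" obtains f where "functional f" "f x = 1"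
  using separation assms by metis

text \<open>The operator \<open>K\<close> of the overview.\<close>

definition defect :: "'a \<Rightarrow> 'a"
  where "defect x = rep (\<lambda>y. \<alpha> x y + cj (\<alpha> y x))"

lemma form_defect: "\<alpha> (defect x) y = \<alpha> x y + cj (\<alpha> y x)"
proof -
  have "conj_functional (\<lambda>y. \<alpha> x y + cj (\<alpha> y x))"
    unfolding conj_functional_def using functional_add[OF form_right_functional form_left_functional]
    by (simp add: cj_add)
  then show ?thesis unfolding defect_def by (simp add: form_rep)
qed

lemma operator_defect: "operator defect"
proof -
  obtain L where L: "L > 0" "\<And>x y. norm (\<alpha> x y) \<le> L * norm x * norm y" using form_bounded by blast
  obtain M where M: "M > 0"
    "\<And>x m. 0 \<le> m \<Longrightarrow> (\<And>y. norm (\<alpha> x y) \<le> m * norm y) \<Longrightarrow> norm x \<le> M * m"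
    using norm_le_of_form by blast
  show ?thesis
  proof (rule operatorI)
    show "defect (x + y) = defect x + defect y" for x y
      by (rule form_eqI) (simp add: form_defect form_left_add form_right_add cj_add)
    show "defect (smul c x) = smul c (defect x)" for c x
      by (rule form_eqI) (simp add: form_defect form_left_smul form_right_smul cj_mult distrib_left)
    show "norm (defect x) \<le> (M * (2 * L)) * norm x" for x
    proof -
      have "norm (\<alpha> (defect x) y) \<le> (2 * L * norm x) * norm y" for y
      proof -
        have "norm (\<alpha> (defect x) y) \<le> norm (\<alpha> x y) + norm (\<alpha> y x)"
          unfolding form_defect by (metis norm_cj norm_triangle_ineq)
        then show ?thesis using L(2)[of x y] L(2)[of y x] by (simp add: mult_ac)
      qed
      then show ?thesis using M(2)[of "2 * L * norm x" "defect x"] L(1) by (simp add: mult.assoc)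
    qed
  qed
qed

lemma semi_fredholm_family:
  assumes t: "0 \<le> t" "t \<le> 1"
  shows "semi_fredholm (\<lambda>x. x - t *\<^sub>R defect x)"
proof (rule ccontr)
  assume not_sf: "\<not> semi_fredholm (\<lambda>x. x - t *\<^sub>R defect x)"
  obtain C where C: "C > 0"
    "\<And>x. x \<noteq> 0 \<Longrightarrow> \<exists>f. functional f \<and> f x = 1 \<and> (\<forall>z. norm (f z) \<le> C / norm x * norm z)"
    using separation by blast
  have "\<exists>f. functional f \<and> f x = 1 \<and> (\<forall>z. norm (f z) \<le> C * norm z)" if "norm x = 1" for x
  proof -
    have "x \<noteq> 0" using that by auto
    then show ?thesis using C(2)[of x] that by simp
  qed
  then obtain M where M: "subspace M" "closed M" "infinite_dimensional smul M"
    "\<And>x. x \<in> M \<Longrightarrow> norm (x - t *\<^sub>R defect x) \<le> 1/2 * norm x"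
    using not_semi_fredholm_small_on_subspace[OF operator_diff[OF operator_ident operator_scaleR[OF operator_defect]] not_sf C(1)]
    by metis
  define s where "s = (\<lambda>x. \<alpha> x + adjoint_on cj (normed_subspace smul UNIV) \<alpha> x)"
  have s: "s x = \<alpha> (defect x)" for x
    by (rule ext) (simp add: s_def form_defect adjoint_on_def plus_fun_def)
  obtain N where N: "N > 0" "\<And>x. norm x \<le> N * nrm D (\<alpha> x)" using norm_le_dual_norm by blast
  \<comment> \<open>On \<open>M\<close>, norm x is at most half of itself plus norm (defect x),
    because t is at most 1; this is the lower bound that strict singularity forbids.\<close>
  have low: "1 / (2 * N) * norm x \<le> nrm D (s x)" if "x \<in> M" for x
  proof -
    have "norm x \<le> norm (x - t *\<^sub>R defect x) + norm (t *\<^sub>R defect x)"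
      by (metis diff_add_cancel norm_triangle_ineq)
    moreover have "norm (t *\<^sub>R defect x) \<le> norm (defect x)" using t by (simp add: mult_left_le_one_le)
    ultimately have "norm x \<le> 2 * norm (defect x)" using M(4)[OF that] by simp
    also have "\<dots> \<le> 2 * (N * nrm D (s x))" using N(2)[of "defect x"] by (simp add: s)
    finally show ?thesis using N(1) by (simp add: field_simps)
  qed
  have bo: "bounded_operator (normed_subspace smul UNIV) D s"
    using strict by (simp add: strictly_singular_def s_def)
  have "bounded_operator (normed_subspace smul M) (D\<lparr>points := s ` M\<rparr>) s"
    using bo unfolding bounded_operator_def by (simp add: subset_eq) blast
  then have "isomorphism (normed_subspace smul M) (D\<lparr>points := s ` M\<rparr>) s"
    using N(1) low by (intro isomorphismI[where c="1 / (2 * N)"] M(1)) auto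
  then show False using strict M(1-3) unfolding strictly_singular_def s_def by blast
qed

lemma index_zero_family: "0 \<le> t \<Longrightarrow> t \<le> 1 \<Longrightarrow> index_zero (\<lambda>x. x - t *\<^sub>R defect x)"
  by (rule index_zero_homotopy[OF operator_defect semi_fredholm_family])

section \<open>Reflexivity\<close>

text \<open>If T x = T y, the form vanishes in its second argument at x - y; since every functional
  comes from the form, all functionals vanish there. So \<open>T\<close> is injective, and index
  zero makes it onto.\<close>

lemma adjoint_surj:
  assumes "conj_functional g" shows "\<exists>x. \<forall>z. g z = cj (\<alpha> z x)"
proof -
  define T where "T = (\<lambda>x. x - 1 *\<^sub>R defect x)"
  have T: "operator T" unfolding T_def
    by (rule operator_diff[OF operator_ident operator_scaleR[OF operator_defect]])
  have form: "\<alpha> (T x) z = - cj (\<alpha> z x)" for x z by (simp add: T_def form_left_diff form_defect)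
  have "inj T"
  proof (rule injI, rule ccontr)
    fix x y assume "T x = T y" "x \<noteq> y"
    then have "T (x - y) = 0" "x - y \<noteq> 0" by (simp_all add: op_diff[OF T])
    then have z: "cj (\<alpha> z (x - y)) = 0" for z using form[of "x - y" z] by simp
    obtain f where f: "functional f" "f (x - y) = 1"
      using \<open>x - y \<noteq> 0\<close> separating_functional by metis
    have "cj (f (x - y)) = \<alpha> (rep (\<lambda>x. cj (f x))) (x - y)"
      by (simp add: form_rep conj_functional_cj f(1))
    then show False using z f(2) by simp
  qed
  then have "surj T" using fredholm_alternative[OF T] index_zero_family[of 1] by (simp add: T_def)
  then obtain x where "rep g = T x" by (metis surjD)
  then have "g z = cj (\<alpha> z (- x))" for z
    using form[of x z] form_rep[OF assms] form_right_diff[of z 0 x] by (simp add: cj_minus)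
  then show ?thesis by blast
qed

text \<open>Reflexivity is stated with the linear dual, the form with the conjugate one. Pulling
  \<Phi> back along the conjugate-linear map \<open>b\<close> gives a conjugate-linear functional,
  which \<open>adjoint_surj\<close> represents by a vector x; \<open>b\<close> reaches every
  functional, so \<Phi> is evaluation at x.\<close>

lemma reflexive_space: "reflexive (normed_subspace smul UNIV)"
  unfolding reflexive_def
proof
  fix \<Phi> assume "\<Phi> \<in> points (dual id (dual id (normed_subspace smul UNIV)))"
  moreover define E where "E = dual id (normed_subspace smul UNIV)"
  ultimately have \<Phi>: "\<Phi> \<in> points (dual id E)" by simp
  have points_E: "f \<in> points E \<longleftrightarrow> functional f" for f
  proof
    assume f: "f \<in> points E"
    then obtain k where "\<And>x. norm (f x) \<le> k * norm x" by (simp add: E_def dual_def) meson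
    then show "functional f" using f by (intro functionalI[where K=k]) (simp_all add: E_def dual_def)
  next
    assume f: "functional f"
    then obtain k where "\<And>x. norm (f x) \<le> k * norm x" using functional_bound by blast
    then show "f \<in> points E" using f by (auto simp: E_def dual_def fn_add fn_smul)
  qed
  define b where "b = (\<lambda>z y. cj (\<alpha> z y))"
  have b: "b z \<in> points E" for z unfolding b_def points_E by (rule form_right_functional)
  have add: "\<Phi> (f + g) = \<Phi> f + \<Phi> g" if "f \<in> points E" "g \<in> points E" for f g
    using \<Phi> that by (simp add: dual_def)
  have scale: "\<Phi> (scl E c f) = c * \<Phi> f" if "f \<in> points E" for f c
    using \<Phi> that by (simp add: dual_def)
  obtain k where k: "\<And>f. f \<in> points E \<Longrightarrow> norm (\<Phi> f) \<le> k * nrm E f"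
    using \<Phi> by (simp add: dual_def) meson
  obtain L where L: "L > 0" "\<And>x y. norm (\<alpha> x y) \<le> L * norm x * norm y" using form_bounded by blast
  have "conj_functional (\<lambda>z. \<Phi> (b z))"
    unfolding conj_functional_def
  proof (rule functionalI[where K="\<bar>k\<bar> * L"])
    have "b (x + y) = b x + b y" for x y by (rule ext) (simp add: b_def form_left_add cj_add)
    then show "cj (\<Phi> (b (x + y))) = cj (\<Phi> (b x)) + cj (\<Phi> (b y))" for x y
      by (simp add: add b cj_add)
    have "b (smul c x) = scl E (cj c) (b x)" for c x
      by (rule ext) (simp add: b_def E_def dual_def form_left_smul cj_mult)
    then show "cj (\<Phi> (b (smul c x))) = c * cj (\<Phi> (b x))" for c x
      by (simp add: scale b cj_mult)
    show "norm (cj (\<Phi> (b z))) \<le> \<bar>k\<bar> * L * norm z" for z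
    proof -
      have "nrm E (b z) \<le> L * norm z" unfolding E_def
        by (rule dual_norm_leI[OF subspace_UNIV]) (use L in \<open>auto simp: b_def\<close>)
      then have "k * nrm E (b z) \<le> \<bar>k\<bar> * (L * norm z)"
        using dual_norm_nonneg[OF subspace_UNIV b[unfolded E_def]] by (intro mult_mono) (auto simp: E_def)
      then show ?thesis using k[OF b, of z] by (simp add: mult.assoc)
    qed
  qed
  then obtain x where x: "\<And>z. \<Phi> (b z) = cj (\<alpha> z x)" using adjoint_surj by blast
  have "\<Phi> f = f x" if "functional f" for f
  proof -
    have "b (rep (\<lambda>y. cj (f y))) = f"
      using form_rep[OF conj_functional_cj[OF that]] by (simp add: b_def)
    then show ?thesis using x[of "rep (\<lambda>y. cj (f y))"] by (simp add: b_def fun_eq_iff)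
  qed
  then show "\<exists>x\<in>points (normed_subspace smul UNIV).
      \<forall>f\<in>points (dual id (normed_subspace smul UNIV)). \<Phi> f = f x"
    using points_E unfolding E_def by auto
qed

section \<open>Skew forms\<close>

text \<open>A form is encoded by the operator \<open>T\<close> with values \<alpha> (T x) y, so that
  its index and its kernel are those of an operator on the space itself.\<close>

definition skew :: "('a \<Rightarrow> 'a) \<Rightarrow> bool"
  where "skew T \<longleftrightarrow> (\<forall>x y. \<alpha> (T x) y = - cj (\<alpha> (T y) x))"

text \<open>Skewness makes the left and the right radical of the form coincide.\<close>

lemma skew_kernel:
  assumes "skew T" "T e = 0" shows "\<alpha> (T x) e = 0"
  using assms unfolding skew_def by (metis form_zero(1) cj_0 neg_equal_0_iff_equal)

text \<open>\<open>G\<close> separates the points of the kernel, so its size bounds the kernel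
  dimension. Each round picks kernel vectors \<open>e\<close> and \<open>u\<close> with dual
  functionals \<open>g\<close> and \<open>f\<close> and adds the skew form built from them; the new
  kernel consists of old kernel vectors annihilated by both.\<close>

lemma skew_reduction:
  assumes "operator T" "index_zero T" "skew T" "finite G" "card G \<le> n" "\<And>g. g \<in> G \<Longrightarrow> functional g"
    "\<And>x. T x = 0 \<Longrightarrow> x \<in> joint_kernel G \<Longrightarrow> x = 0"
  shows "\<exists>T. operator T \<and> index_zero T \<and> skew T \<and>
    ((\<forall>x. T x = 0 \<longrightarrow> x = 0) \<or> (\<exists>e. e \<noteq> 0 \<and> T e = 0 \<and> (\<forall>x. T x = 0 \<longrightarrow> (\<exists>a. x = smul a e))))"
  using assms
proof (induction n arbitrary: T G)
  case 0
  then have "\<forall>x. T x = 0 \<longrightarrow> x = 0" by (simp add: joint_kernel_def)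
  then show ?case using 0 by blast
next
  case (Suc n)
  note T = Suc.prems(1)
  show ?case
  proof (cases "\<forall>x. T x = 0 \<longrightarrow> x = 0")
    case True
    then show ?thesis using Suc.prems by blast
  next
    case False
    then obtain e1 where e1: "T e1 = 0" "e1 \<noteq> 0" by blast
    then obtain g where g: "g \<in> G" "g e1 \<noteq> 0"
      using Suc.prems(7) by (auto simp: joint_kernel_def)
    have gf: "functional g" using g(1) Suc.prems(6) by simp
    define e where "e = smul (1 / g e1) e1"
    have ge: "g e = 1" using g(2) by (simp add: e_def fn_smul[OF gf])
    have Te: "T e = 0" by (simp add: e_def op_smul[OF T] e1(1))
    show ?thesis
    proof (cases "\<forall>x. T x = 0 \<longrightarrow> g x = 0 \<longrightarrow> x = 0")
      case True
      have "\<exists>a. x = smul a e" if "T x = 0" for x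
      proof -
        have "T (x - smul (g x) e) = 0" "g (x - smul (g x) e) = 0"
          using that Te ge by (simp_all add: op_diff[OF T] op_smul[OF T] fn_diff[OF gf] fn_smul[OF gf])
        then have "x = smul (g x) e" using True by (metis eq_iff_diff_eq_0)
        then show ?thesis by blast
      qed
      moreover have "e \<noteq> 0" using ge fn_zero[OF gf] by auto
      ultimately show ?thesis using Suc.prems Te by blast
    next
      case False
      then obtain u where u: "T u = 0" "g u = 0" "u \<noteq> 0" by blast
      obtain f0 where f0: "functional f0" "f0 u = 1" using separating_functional[OF u(3)] by blast
      \<comment> \<open>The correction gives f e = 0 and, as g u = 0, keeps f u = 1: now g, f are
        dual to e, u.\<close>
      define f where "f = (\<lambda>x. f0 x - f0 e * g x)"
      have f: "functional f" unfolding f_def by (rule functional_diff[OF f0(1) functional_mult[OF gf]])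
      have fe: "f e = 0" and fu: "f u = 1" by (simp_all add: f_def ge f0 u)
      define T' where "T' = (\<lambda>x. T x + (smul (g x) (rep (\<lambda>y. cj (f y))) + smul (f x) (- rep (\<lambda>y. cj (g y)))))"
      have fr: "finite_rank (\<lambda>x. smul (g x) (rep (\<lambda>y. cj (f y))) + smul (f x) (- rep (\<lambda>y. cj (g y))))"
        by (rule finite_rank_add[OF finite_rank_one[OF f] finite_rank_one[OF gf]])
      have form: "\<alpha> (T' x) y = \<alpha> (T x) y + g x * cj (f y) - f x * cj (g y)" for x y
        using form_left_diff[of 0 "rep (\<lambda>y. cj (g y))" y]
        by (simp add: T'_def form_left_add form_left_smul form_rep conj_functional_cj f gf del: scale_minus_right)
      have "skew T'"
        unfolding skew_def form
      proof (intro allI)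
        fix x y
        have "\<alpha> (T x) y = - cj (\<alpha> (T y) x)" using Suc.prems(3) unfolding skew_def by blast
        then show "\<alpha> (T x) y + g x * cj (f y) - f x * cj (g y) =
            - cj (\<alpha> (T y) x + g y * cj (f x) - f y * cj (g x))"
          by (simp add: cj_add cj_diff cj_mult mult.commute)
      qed
      moreover have ker: "T x = 0" "g x = 0" if "T' x = 0" for x
      proof -
        \<comment> \<open>Testing the new form against \<open>e\<close> and \<open>u\<close>
          isolates f x and g x, since the old form vanishes at kernel vectors.\<close>
        have "\<alpha> (T x) e + g x * cj (f e) - f x * cj (g e) = 0"
          "\<alpha> (T x) u + g x * cj (f u) - f x * cj (g u) = 0"
          unfolding form[symmetric] that by simp_all
        then have "f x = 0" and "g x = 0"
          using skew_kernel[OF Suc.prems(3)] Te u(1,2) fe ge fu by simp_all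
        then show "T x = 0" "g x = 0" using that by (simp_all add: T'_def)
      qed
      moreover have "x = 0" if "T' x = 0" "x \<in> joint_kernel (G - {g})" for x
        using ker[OF that(1)] that(2) Suc.prems(7) by (auto simp: joint_kernel_def)
      moreover have "card (G - {g}) \<le> n" using Suc.prems(4,5) g(1) by (simp add: card_Diff_singleton)
      moreover have "operator T'" unfolding T'_def by (rule operator_add[OF T finite_rank_operator[OF fr]])
      moreover have "index_zero T'" unfolding T'_def by (rule index_zero_add_finite_rank[OF Suc.prems(2) fr])
      moreover have "finite (G - {g})" "\<And>g'. g' \<in> G - {g} \<Longrightarrow> functional g'"
        using Suc.prems(4,6) by simp_all
      ultimately show ?thesis by (intro Suc.IH[of T' "G - {g}"])
    qed
  qed
qed

lemma skew_index_zero_exists: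
  "\<exists>T. operator T \<and> index_zero T \<and> skew T \<and>
    ((\<forall>x. T x = 0 \<longrightarrow> x = 0) \<or> (\<exists>e. e \<noteq> 0 \<and> T e = 0 \<and> (\<forall>x. T x = 0 \<longrightarrow> (\<exists>a. x = smul a e))))"
proof -
  define T where "T = (\<lambda>x. x - (1/2) *\<^sub>R defect x)"
  have T: "operator T" unfolding T_def
    by (rule operator_diff[OF operator_ident operator_scaleR[OF operator_defect]])
  have ind: "index_zero T" unfolding T_def by (rule index_zero_family) auto
  have half: "\<alpha> ((1/2) *\<^sub>R z) y = of_real (1/2) * \<alpha> z y" for z y
    by (simp only: smul_of_real[symmetric] form_left_smul)
  have form: "\<alpha> (T x) y = of_real (1/2) * (\<alpha> x y - cj (\<alpha> y x))" for x y
  proof -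
    have "\<alpha> x y = of_real (1/2) * \<alpha> x y + of_real (1/2) * \<alpha> x y"
      unfolding distrib_right[symmetric] of_real_add[symmetric] by simp
    then show ?thesis
      unfolding T_def form_left_diff half form_defect right_diff_distrib distrib_left
      by (metis add_diff_cancel_left diff_diff_add)
  qed
  have "skew T" unfolding skew_def form by (simp add: cj_mult cj_diff right_diff_distrib del: of_real_divide)
  \<comment> \<open>A family on whose joint kernel \<open>T\<close> is bounded below separates the
    points of the kernel of \<open>T\<close>, which starts the reduction.\<close>
  obtain G where G: "finite G" "\<forall>g\<in>G. functional g" "bounded_below_on (joint_kernel G) T"
    using index_zero_semi_fredholm[OF ind] by (auto simp: semi_fredholm_def)
  have "x = 0" if x: "T x = 0" "x \<in> joint_kernel G" for x
  proof -
    obtain c where "c > 0" "c * norm x \<le> norm (T x)" using G(3) x(2) by (auto simp: bounded_below_on_def)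
    then show ?thesis using x(1) by (simp add: mult_le_0_iff)
  qed
  with skew_reduction[OF T ind \<open>skew T\<close> G(1) order_refl bspec[OF G(2)]] show ?thesis by simp
qed

section \<open>Symplectic structures on the space and on its closed hyperplanes\<close>

lemma bijective_index_zero:
  assumes T: "operator T" and ind: "index_zero T" and ker: "\<And>x. T x = 0 \<Longrightarrow> x = 0"
  shows "surj T" "bounded_below_on UNIV T"
proof -
  have "inj T" by (rule injI) (metis T eq_iff_diff_eq_0 ker op_diff)
  then show "surj T" "bounded_below_on UNIV T"
    using fredholm_alternative[OF T ind] semi_fredholm_inj_bounded_below[OF T _ index_zero_semi_fredholm[OF ind]]
    by auto
qed

lemma symplectic_whole:
  assumes T: "operator T" and ind: "index_zero T" and skew: "skew T" and ker: "\<And>x. T x = 0 \<Longrightarrow> x = 0"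
  shows "admits_symplectic cj (normed_subspace smul UNIV)"
proof -
  note bij = bijective_index_zero[OF T ind ker]
  obtain c where c: "c > 0" "\<And>x. c * norm x \<le> norm (T x)" using bij(2) by (auto simp: bounded_below_on_def)
  obtain k where k: "k > 0" "\<And>x. norm (T x) \<le> k * norm x" using operator_bound[OF T] by blast
  obtain N where N: "N > 0" "\<And>x. norm x \<le> N * nrm D (\<alpha> x)" using norm_le_dual_norm by blast
  obtain L where L: "L > 0" "\<And>x y. norm (\<alpha> x y) \<le> L * norm x * norm y" using form_bounded by blast
  have "bounded_operator (normed_subspace smul UNIV) D (\<lambda>x. \<alpha> (T x))"
    unfolding bounded_operator_def normed_subspace_simps
  proof (intro conjI ballI allI exI[of _ "L * k"])
    show "\<alpha> (T x) \<in> points D" for x using points_D conj_functional_form by auto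
    show "\<alpha> (T (x + y)) = \<alpha> (T x) + \<alpha> (T y)" for x y
      by (rule ext) (simp add: op_add[OF T] form_left_add)
    show "\<alpha> (T (smul a x)) = scl D a (\<alpha> (T x))" for a x
      by (rule ext) (simp add: op_smul[OF T] form_left_smul dual_def)
    show "nrm D (\<alpha> (T x)) \<le> L * k * norm x" for x
    proof (rule dual_norm_leI[OF subspace_UNIV])
      show "0 \<le> L * k * norm x" using L k by simp
      have "L * norm (T x) \<le> L * (k * norm x)" using L(1) k(2) by (intro mult_left_mono) auto
      then have "L * norm (T x) * norm y \<le> L * (k * norm x) * norm y" for y
        by (rule mult_right_mono) simp
      from order_trans[OF L(2) this] show "norm (\<alpha> (T x) y) \<le> L * k * norm x * norm y" for y
        by (simp add: mult.assoc)
    qed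
  qed
  moreover have "range (\<lambda>x. \<alpha> (T x)) = points D"
  proof (intro antisym subsetI)
    fix g assume "g \<in> points D"
    then have "\<alpha> (rep g) = g" using points_D form_rep by auto
    moreover obtain x where "rep g = T x" using bij(1) by (metis surjD)
    ultimately show "g \<in> range (\<lambda>x. \<alpha> (T x))" by (metis rangeI)
  qed (use points_D conj_functional_form in auto)
  moreover have "c / N * norm x \<le> nrm D (\<alpha> (T x))" for x
    using order_trans[OF c(2) N(2), of x] N(1) by (simp add: field_simps)
  ultimately have "isomorphism (normed_subspace smul UNIV) D (\<lambda>x. \<alpha> (T x))"
    using c(1) N(1) by (intro isomorphismI[where c="c / N"]) auto
  moreover have "adjoint_on cj (normed_subspace smul UNIV) (\<lambda>x. \<alpha> (T x)) x = - \<alpha> (T x)" for x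
    using skew[unfolded skew_def, rule_format, of x] by (auto simp: adjoint_on_def)
  ultimately show ?thesis unfolding admits_symplectic_def by blast
qed

text \<open>The functional reads off the coefficient of \<open>v\<close> modulo \<open>H\<close>;
  closedness of \<open>H\<close> bounds it through the distance from \<open>v\<close> to
  \<open>H\<close>.\<close>

lemma closed_hyperplane_kernel:
  assumes "closed_hyperplane smul H"
  obtains f v where "functional f" "f v = 1" "H = {x. f x = 0}"
proof -
  obtain v where H: "subspace H" "closed H" "v \<notin> H" "span (insert v H) = UNIV"
    using assms by (auto simp: closed_hyperplane_def)
  have ex: "\<exists>a. x - smul a v \<in> H" for x
  proof -
    have "x \<in> span (insert v H)" using H(4) by simp
    then show ?thesis using H(1) unfolding span_breakdown_eq by (metis span_eq_iff)
  qed
  have uniq: "a = b" if "x - smul a v \<in> H" "x - smul b v \<in> H" for x a b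
  proof (rule ccontr)
    assume "a \<noteq> b"
    have "smul (b - a) v \<in> H" using subspace_diff[OF H(1) that] by (simp add: scale_left_diff_distrib)
    from subspace_scale[OF H(1) this, of "1 / (b - a)"] \<open>a \<noteq> b\<close> show False using H(3) by simp
  qed
  define f where "f x = (THE a. x - smul a v \<in> H)" for x
  have f: "x - smul (f x) v \<in> H" for x
    unfolding f_def using ex[of x] uniq[of x] by (metis (mono_tags, lifting) theI)
  have f_eq: "f x = a" if "x - smul a v \<in> H" for x a using uniq[OF f that] .
  have "open (- H)" using H(2) by (simp add: open_Compl)
  then obtain d where d: "d > 0" "ball v d \<subseteq> - H" using H(3) unfolding open_contains_ball by blast
  have "functional f"
  proof (rule functionalI[where K="1/d"])
    show "f (x + y) = f x + f y" for x y
      using subspace_add[OF H(1) f[of x] f[of y]] by (intro f_eq) (simp add: scale_left_distrib algebra_simps)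
    show "f (smul c x) = c * f x" for c x
      using subspace_scale[OF H(1) f[of x], of c] by (intro f_eq) (simp add: scale_right_diff_distrib)
    show "norm (f x) \<le> 1/d * norm x" for x
    proof (cases "f x = 0")
      case False
      \<comment> \<open>Chosen in \<open>H\<close> so that v - h = x / f x, whose norm is then at
        least \<open>d\<close>.\<close>
      define h where "h = smul (- 1 / f x) (x - smul (f x) v)"
      have "h \<in> H" unfolding h_def by (rule subspace_scale[OF H(1) f])
      then have "d \<le> norm (v - h)" using d(2) by (force simp: dist_norm)
      also have "v - h = smul (1 / f x) x"
        using False by (simp add: h_def scale_right_diff_distrib scale_minus_left)
      finally show ?thesis using False d(1) by (simp add: norm_smul norm_divide field_simps)
    qed (use d in simp)
  qed
  moreover have "f v = 1" by (rule f_eq) (simp add: subspace_0[OF H(1)])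
  moreover have "H = {x. f x = 0}"
    using f f_eq[of _ 0] by (auto, metis diff_zero scale_zero_left)
  ultimately show ?thesis by (rule that)
qed

text \<open>The reflection exchanging \<open>e\<close> and \<open>v\<close> moves the kernel of the form off the hyperplane.\<close>

lemma move_kernel:
  assumes T: "operator T" and ind: "index_zero T" and skew: "skew T" and e: "e \<noteq> 0" "T e = 0"
    and ker: "\<And>x. T x = 0 \<Longrightarrow> \<exists>a. x = smul a e"
    and f: "functional f" "f v = 1" "f e = 0"
  shows "\<exists>T'. operator T' \<and> index_zero T' \<and> skew T' \<and> T' v = 0 \<and> (\<forall>x. T' x = 0 \<longrightarrow> (\<exists>a. x = smul a v))"
proof -
  obtain g0 where g0: "functional g0" "g0 e = 1" using separating_functional[OF e(1)] by blast
  \<comment> \<open>The coefficient forces h v = -1; because f e = 0, the value h e = 1 survives.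
    With u = e - v this gives h u = 2, which makes \<phi> an involution exchanging \<open>e\<close>
    and \<open>v\<close>.\<close>
  define h where "h = (\<lambda>x. g0 x - (1 + g0 v) * f x)"
  have h: "functional h" unfolding h_def by (rule functional_diff[OF g0(1) functional_mult[OF f(1)]])
  have he: "h e = 1" and hv: "h v = - 1" by (simp_all add: h_def f g0)
  define u where "u = e - v"
  have hu: "h u = 2" by (simp add: u_def fn_diff[OF h] he hv)
  define \<phi> where "\<phi> x = x - smul (h x) u" for x
  have \<phi>: "operator \<phi>" unfolding \<phi>_def by (rule operator_diff[OF operator_ident operator_rank_one[OF h]])
  have \<phi>e: "\<phi> v = e" by (simp add: \<phi>_def hv u_def scale_minus_left)
  have \<phi>v: "\<phi> e = v" by (simp add: \<phi>_def he u_def)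
  have invol: "\<phi> (\<phi> x) = x" for x
  proof -
    have "h (\<phi> x) = - h x" by (simp add: \<phi>_def fn_diff[OF h] fn_smul[OF h] hu)
    then show ?thesis unfolding \<phi>_def[of "\<phi> x"] by (simp add: \<phi>_def scale_minus_left)
  qed
  define q where "q x = \<alpha> (T (\<phi> x)) u" for x
  have q: "functional q" unfolding q_def
    by (rule functional_comp[OF form_left_functional operator_comp[OF T \<phi>]])
  \<comment> \<open>Obtained by expanding the congruent form \<alpha> (T (\<phi> x)) (\<phi> y): it
    differs from the old form by finite rank, so index zero is kept.\<close>
  define R where "R = (\<lambda>x. smul (h x) (- T u) + smul (q x) (- rep (\<lambda>y. cj (h y))))"
  have R: "finite_rank R" unfolding R_def by (rule finite_rank_add[OF finite_rank_one[OF q] finite_rank_one[OF h]])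
  define T' where "T' = (\<lambda>x. T x + R x)"
  have form: "\<alpha> (T' x) y = \<alpha> (T (\<phi> x)) (\<phi> y)" for x y
  proof -
    have "T (\<phi> x) = T x - smul (h x) (T u)" by (simp add: \<phi>_def op_diff[OF T] op_smul[OF T])
    then have "T' x = T (\<phi> x) - smul (q x) (rep (\<lambda>y. cj (h y)))"
      by (simp add: T'_def R_def)
    then show ?thesis
      unfolding \<phi>_def[of y]
      by (simp add: form_left_diff form_right_diff form_left_smul form_right_smul form_rep conj_functional_cj h q_def mult.commute)
  qed
  have T'_iff: "T' x = 0 \<longleftrightarrow> T (\<phi> x) = 0" for x
  proof
    assume "T' x = 0"
    then have "\<alpha> (T (\<phi> x)) (\<phi> (\<phi> y)) = 0" for y using form[of x "\<phi> y"] by simp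
    then show "T (\<phi> x) = 0" by (intro form_eqI) (simp add: invol)
  next
    assume "T (\<phi> x) = 0"
    then show "T' x = 0" by (intro form_eqI) (simp add: form)
  qed
  have "operator T'" unfolding T'_def by (rule operator_add[OF T finite_rank_operator[OF R]])
  moreover have "index_zero T'" unfolding T'_def by (rule index_zero_add_finite_rank[OF ind R])
  moreover have "skew T'" using skew unfolding skew_def form by blast
  moreover have "T' v = 0" by (simp add: T'_iff \<phi>e e)
  moreover have "\<exists>a. x = smul a v" if x: "T' x = 0" for x
  proof -
    obtain a where "\<phi> x = smul a e" using ker x T'_iff by blast
    then have "x = smul a v" using invol[of x] \<phi>v op_smul[OF \<phi>] by metis
    then show ?thesis ..
  qed
  ultimately show ?thesis by blast
qed

text \<open>\<open>H\<close> is complementary to the radical spanned by \<open>e\<close>, so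
  restricting the form loses nothing. To invert the restriction, the missing direction is filled by
  the rank-one form f x cj (f y), which vanishes on \<open>H\<close>; the resulting \<open>S\<close>
  is bijective, and the equation is solved for \<open>S\<close> first.\<close>

lemma symplectic_transversal_hyperplane:
  assumes T: "operator T" and ind: "index_zero T" and skew: "skew T" and e: "T e = 0"
    and ker: "\<And>x. T x = 0 \<Longrightarrow> \<exists>a. x = smul a e" and f: "functional f" "f e = 1"
  shows "admits_symplectic cj (normed_subspace smul {x. f x = 0})"
proof -
  define H where "H = {x. f x = 0}"
  have H: "subspace H"
    unfolding H_def by (intro subspaceI) (auto simp: fn_zero[OF f(1)] fn_add[OF f(1)] fn_smul[OF f(1)])
  define \<pi> where "\<pi> y = y - smul (f y) e" for y
  have \<pi>: "\<pi> y \<in> H" for y by (simp add: H_def \<pi>_def fn_diff[OF f(1)] fn_smul[OF f(1)] f(2))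
  have \<pi>_op: "operator \<pi>" unfolding \<pi>_def
    by (rule operator_diff[OF operator_ident operator_rank_one[OF f(1)]])
  have \<pi>_id: "\<pi> y = y" if "y \<in> H" for y using that by (simp add: H_def \<pi>_def)
  obtain P where P: "P > 0" "\<And>y. norm (\<pi> y) \<le> P * norm y" using operator_bound[OF \<pi>_op] by blast
  have T\<pi>: "\<alpha> (T x) (\<pi> y) = \<alpha> (T x) y" for x y
    by (simp add: \<pi>_def form_right_diff form_right_smul skew_kernel[OF skew e])
  define S where "S = (\<lambda>x. T x + smul (f x) (rep (\<lambda>y. cj (f y))))"
  have S: "operator S" unfolding S_def by (rule operator_add[OF T operator_rank_one[OF f(1)]])
  have Sind: "index_zero S" unfolding S_def by (rule index_zero_add_finite_rank[OF ind finite_rank_one[OF f(1)]])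
  have S_form: "\<alpha> (S x) y = \<alpha> (T x) y + f x * cj (f y)" for x y
    by (simp add: S_def form_left_add form_left_smul form_rep conj_functional_cj f(1))
  have Se: "\<alpha> (S x) e = f x" for x by (simp add: S_form skew_kernel[OF skew e] f(2))
  have S_T: "S x = T x" if "x \<in> H" for x using that by (simp add: S_def H_def)
  have "x = 0" if "S x = 0" for x
  proof -
    have fx: "f x = 0" using Se[of x] that by simp
    then have "T x = 0" using that by (simp add: S_def)
    then obtain a where "x = smul a e" using ker by blast
    then show ?thesis using fx f by (simp add: fn_smul[OF f(1)])
  qed
  note bij = bijective_index_zero[OF S Sind this]
  obtain c where c: "c > 0" "\<And>x. c * norm x \<le> norm (S x)" using bij(2) by (auto simp: bounded_below_on_def)
  obtain k where k: "k > 0" "\<And>x. norm (T x) \<le> k * norm x" using operator_bound[OF T] by blast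
  obtain M where M: "M > 0"
    "\<And>x m. 0 \<le> m \<Longrightarrow> (\<And>y. norm (\<alpha> x y) \<le> m * norm y) \<Longrightarrow> norm x \<le> M * m"
    using norm_le_of_form by blast
  obtain L where L: "L > 0" "\<And>x y. norm (\<alpha> x y) \<le> L * norm x * norm y" using form_bounded by blast
  define DH where "DH = dual cj (normed_subspace smul H)"
  \<comment> \<open>The value 0 off \<open>H\<close> is the convention by which \<open>dual\<close>
    represents functionals on a subspace.\<close>
  define b where "b x = (\<lambda>y. if y \<in> H then \<alpha> (T x) y else 0)" for x
  have b_bound: "norm (b x y) \<le> L * k * norm x * norm y" if "y \<in> H" for x y
  proof -
    have "L * norm (T x) \<le> L * (k * norm x)" using L(1) k(2) by (intro mult_left_mono) auto
    then have "L * norm (T x) * norm y \<le> L * (k * norm x) * norm y" by (rule mult_right_mono) simp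
    then show ?thesis using L(2)[of "T x" y] that by (simp add: b_def mult.assoc)
  qed
  have b_points: "b x \<in> points DH" for x
    using b_bound[of _ x] subspace_add[OF H] subspace_scale[OF H]
    by (auto simp: DH_def dual_def b_def form_right_add form_right_smul)
  have "bounded_operator (normed_subspace smul H) DH b"
    unfolding bounded_operator_def normed_subspace_simps
  proof (intro conjI ballI allI exI[of _ "L * k"] b_points)
    show "b (x + y) = b x + b y" for x y
      by (rule ext) (simp add: b_def op_add[OF T] form_left_add)
    show "b (smul a x) = scl DH a (b x)" for a x
      by (rule ext) (simp add: b_def op_smul[OF T] form_left_smul dual_def DH_def)
    show "nrm DH (b x) \<le> L * k * norm x" for x
      unfolding DH_def by (rule dual_norm_leI[OF H]) (use L(1) k(1) b_bound in auto)
  qed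
  moreover have "b ` H = points DH"
  proof (intro antisym subsetI)
    fix g assume g: "g \<in> points DH"
    then have g_add: "g (x + y) = g x + g y" and g_smul: "g (smul a x) = cj a * g x"
      if "x \<in> H" "y \<in> H" for x y a
      using that by (simp_all add: DH_def dual_def)
    have g0: "g 0 = 0" using g_add[of 0 0] subspace_0[OF H] by simp
    have gn: "norm (g y) \<le> nrm DH g * norm y" if "y \<in> H" for y
      using dual_norm_le[OF H norm_cj] g that by (simp add: DH_def)
    have "conj_functional (\<lambda>y. g (\<pi> y))"
      unfolding conj_functional_def
    proof (rule functionalI[where K="nrm DH g * P"])
      show "cj (g (\<pi> (x + y))) = cj (g (\<pi> x)) + cj (g (\<pi> y))" for x y
        by (simp add: op_add[OF \<pi>_op] g_add \<pi> cj_add)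
      show "cj (g (\<pi> (smul a x))) = a * cj (g (\<pi> x))" for a x
        by (simp add: op_smul[OF \<pi>_op] g_smul[OF \<pi> \<pi>] cj_mult)
      show "norm (cj (g (\<pi> y))) \<le> nrm DH g * P * norm y" for y
      proof -
        have "0 \<le> nrm DH g" using dual_norm_nonneg[OF H] g by (simp add: DH_def)
        then have "nrm DH g * norm (\<pi> y) \<le> nrm DH g * (P * norm y)" by (rule mult_left_mono[OF P(2)])
        then show ?thesis using gn[OF \<pi>, of y] by (simp add: mult.assoc)
      qed
    qed
    then have "\<alpha> (rep (\<lambda>y. g (\<pi> y))) = (\<lambda>y. g (\<pi> y))" by (rule form_rep)
    then obtain x where x: "\<And>y. \<alpha> (S x) y = g (\<pi> y)" using bij(1) by (metis surjD)
    \<comment> \<open>Evaluating at \<open>e\<close>: the left side is f x, and \<pi> e = 0 on the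
      right. Thus the solution for \<open>S\<close> lies in \<open>H\<close>, where \<open>S\<close>
      and T agree.\<close>
    have "f x = 0" using x[of e] by (simp add: Se) (simp add: \<pi>_def f(2) g0)
    then have xH: "x \<in> H" by (simp add: H_def)
    have "g y = 0" if "y \<notin> H" for y using g that by (simp add: DH_def dual_def)
    then have "g = b x" using x S_T[OF xH] \<pi>_id by (auto simp: b_def)
    then show "g \<in> b ` H" using xH by blast
  qed (use b_points in auto)
  moreover have "c / (M * P) * norm x \<le> nrm DH (b x)" if x: "x \<in> H" for x
  proof -
    have nonneg: "0 \<le> nrm DH (b x)" using dual_norm_nonneg[OF H] b_points by (simp add: DH_def)
    \<comment> \<open>Projecting y to \<open>H\<close> along \<open>e\<close> does not change the
      form, so its norm over the whole space is controlled by its norm over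
      \<open>H\<close>.\<close>
    have "norm (\<alpha> (T x) y) \<le> (nrm DH (b x) * P) * norm y" for y
    proof -
      have "norm (\<alpha> (T x) y) = norm (b x (\<pi> y))" using \<pi> by (simp add: b_def T\<pi>)
      also have "\<dots> \<le> nrm DH (b x) * norm (\<pi> y)"
        using dual_norm_le[OF H norm_cj] b_points \<pi> by (simp add: DH_def)
      also have "\<dots> \<le> nrm DH (b x) * (P * norm y)" by (rule mult_left_mono[OF P(2) nonneg])
      finally show ?thesis by (simp add: mult.assoc)
    qed
    then have "norm (T x) \<le> M * (nrm DH (b x) * P)" using nonneg P(1) by (intro M(2)) auto
    then have "c * norm x \<le> M * P * nrm DH (b x)" using c(2)[of x] S_T[OF x] by (simp add: mult_ac)
    then show ?thesis using M(1) P(1) by (simp add: pos_divide_le_eq mult.commute)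
  qed
  ultimately have "isomorphism (normed_subspace smul H) DH b"
    using c(1) M(1) P(1) by (intro isomorphismI[where c="c / (M * P)"] H) auto
  moreover have "adjoint_on cj (normed_subspace smul H) b x = - b x" if "x \<in> H" for x
    using skew[unfolded skew_def, rule_format, of x] that by (auto simp: adjoint_on_def b_def)
  ultimately show ?thesis unfolding admits_symplectic_def H_def DH_def by auto
qed

lemma symplectic_space_or_hyperplanes:
  "admits_symplectic cj (normed_subspace smul UNIV) \<or>
    (\<forall>H. closed_hyperplane smul H \<longrightarrow> admits_symplectic cj (normed_subspace smul H))"
proof -
  obtain T where T: "operator T" "index_zero T" "skew T" and cases: "(\<forall>x. T x = 0 \<longrightarrow> x = 0) \<or>
      (\<exists>e. e \<noteq> 0 \<and> T e = 0 \<and> (\<forall>x. T x = 0 \<longrightarrow> (\<exists>a. x = smul a e)))"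
    using skew_index_zero_exists by (elim exE conjE) (rule that)
  from cases show ?thesis
  proof
    assume "\<forall>x. T x = 0 \<longrightarrow> x = 0"
    then show ?thesis using symplectic_whole[OF T] by blast
  next
    assume "\<exists>e. e \<noteq> 0 \<and> T e = 0 \<and> (\<forall>x. T x = 0 \<longrightarrow> (\<exists>a. x = smul a e))"
    then obtain e where e: "e \<noteq> 0" "T e = 0" "\<And>x. T x = 0 \<Longrightarrow> \<exists>a. x = smul a e" by blast
    have "admits_symplectic cj (normed_subspace smul H)" if hyp: "closed_hyperplane smul H" for H
    proof -
      obtain f v where f: "functional f" "f v = 1" "H = {x. f x = 0}"
        using closed_hyperplane_kernel[OF hyp] by blast
      show ?thesis
      proof (cases "f e = 0")
        case True
        \<comment> \<open>Here the kernel line lies inside \<open>H\<close>; it is moved to the line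
          of \<open>v\<close>, which is transversal as f v = 1.\<close>
        obtain T' where "operator T'" "index_zero T'" "skew T'" "T' v = 0"
          "\<And>x. T' x = 0 \<Longrightarrow> \<exists>a. x = smul a v"
          using move_kernel[OF T e f(1,2) True] by blast
        then show ?thesis unfolding f(3) using f(1,2) by (rule symplectic_transversal_hyperplane)
      next
        case False
        define e' where "e' = smul (1 / f e) e"
        have "f e' = 1" using False by (simp add: e'_def fn_smul[OF f(1)])
        moreover have "T e' = 0" by (simp add: e'_def op_smul[OF T(1)] e(2))
        moreover have "\<exists>a. x = smul a e'" if x: "T x = 0" for x
        proof -
          obtain a where "x = smul a e" using e(3)[OF x] by blast
          then have "x = smul (a * f e) e'" using False by (simp add: e'_def)
          then show ?thesis ..
        qed
        ultimately show ?thesis unfolding f(3) using T f(1) by (intro symplectic_transversal_hyperplane[of T e']) auto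
      qed
    qed
    then show ?thesis by blast
  qed
qed

end

section \<open>The real and the complex instance\<close>

lemma almost_symplectic_real:
  assumes "admits_almost_symplectic id ((*\<^sub>R) :: real \<Rightarrow> 'a::banach \<Rightarrow> 'a)"
  shows "\<exists>\<alpha>. almost_symplectic_space ((*\<^sub>R) :: real \<Rightarrow> 'a \<Rightarrow> 'a) id \<alpha>"
proof -
  interpret scalar_banach "(*\<^sub>R) :: real \<Rightarrow> 'a \<Rightarrow> 'a"
    by unfold_locales (simp_all add: scaleR_right_distrib scaleR_left_distrib)
  obtain \<alpha> where "isomorphism (normed_subspace (*\<^sub>R) UNIV) (dual id (normed_subspace (*\<^sub>R) UNIV)) \<alpha>"
    "strictly_singular (*\<^sub>R) (dual id (normed_subspace (*\<^sub>R) UNIV))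
      (\<lambda>x. \<alpha> x + adjoint_on id (normed_subspace (*\<^sub>R) (UNIV :: 'a set)) \<alpha> x)"
    using assms unfolding admits_almost_symplectic_def Let_def by blast
  then have "almost_symplectic_space ((*\<^sub>R) :: real \<Rightarrow> 'a \<Rightarrow> 'a) id \<alpha>"
    by unfold_locales simp_all
  then show ?thesis by blast
qed

lemma almost_symplectic_complex:
  fixes scaleC :: "complex \<Rightarrow> 'b::banach \<Rightarrow> 'b"
  assumes "complex_banach scaleC" "admits_almost_symplectic cnj scaleC"
  shows "\<exists>\<alpha>. almost_symplectic_space scaleC cnj \<alpha>"
proof -
  interpret complex_banach scaleC by fact
  interpret scalar_banach scaleC
    by unfold_locales (rule scaleC_of_real norm_scaleC)+
  obtain \<alpha> where "isomorphism (normed_subspace scaleC UNIV) (dual cnj (normed_subspace scaleC UNIV)) \<alpha>"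
    "strictly_singular scaleC (dual cnj (normed_subspace scaleC UNIV))
      (\<lambda>x. \<alpha> x + adjoint_on cnj (normed_subspace scaleC UNIV) \<alpha> x)"
    using assms(2) unfolding admits_almost_symplectic_def Let_def by blast
  then have "almost_symplectic_space scaleC cnj \<alpha>"
    by unfold_locales simp_all
  then show ?thesis by blast
qed

theorem proposition8p7:
  fixes scaleC :: "complex \<Rightarrow> 'b::banach \<Rightarrow> 'b"
  shows
    "(admits_almost_symplectic id ((*\<^sub>R) :: real \<Rightarrow> 'a::banach \<Rightarrow> 'a) \<longrightarrow>
        (admits_symplectic id (normed_subspace (*\<^sub>R) (UNIV :: 'a set)) \<or>
          (\<forall>H :: 'a set. closed_hyperplane (*\<^sub>R) H \<longrightarrow>
             admits_symplectic id (normed_subspace (*\<^sub>R) H))) \<and>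
        reflexive (normed_subspace (*\<^sub>R) (UNIV :: 'a set))) \<and>
     (complex_banach scaleC \<and> admits_almost_symplectic cnj scaleC \<longrightarrow>
        (admits_symplectic cnj (normed_subspace scaleC UNIV) \<or>
          (\<forall>H. closed_hyperplane scaleC H \<longrightarrow>
             admits_symplectic cnj (normed_subspace scaleC H))) \<and>
        reflexive (normed_subspace scaleC UNIV))"
proof (intro conjI[of "_ \<longrightarrow> _"] impI)
  assume "admits_almost_symplectic id ((*\<^sub>R) :: real \<Rightarrow> 'a \<Rightarrow> 'a)"
  then obtain \<alpha> where "almost_symplectic_space ((*\<^sub>R) :: real \<Rightarrow> 'a \<Rightarrow> 'a) id \<alpha>"
    using almost_symplectic_real by blast
  then interpret almost_symplectic_space "(*\<^sub>R) :: real \<Rightarrow> 'a \<Rightarrow> 'a" id \<alpha> .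
  show "(admits_symplectic id (normed_subspace (*\<^sub>R) (UNIV :: 'a set)) \<or>
      (\<forall>H :: 'a set. closed_hyperplane (*\<^sub>R) H \<longrightarrow> admits_symplectic id (normed_subspace (*\<^sub>R) H))) \<and>
    reflexive (normed_subspace (*\<^sub>R) (UNIV :: 'a set))"
    using symplectic_space_or_hyperplanes reflexive_space by blast
next
  assume "complex_banach scaleC \<and> admits_almost_symplectic cnj scaleC"
  then obtain \<alpha> where "almost_symplectic_space scaleC cnj \<alpha>" using almost_symplectic_complex by blast
  then interpret almost_symplectic_space scaleC cnj \<alpha> .
  show "(admits_symplectic cnj (normed_subspace scaleC UNIV) \<or>
      (\<forall>H. closed_hyperplane scaleC H \<longrightarrow> admits_symplectic cnj (normed_subspace scaleC H))) \<and>
    reflexive (normed_subspace scaleC UNIV)"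
    using symplectic_space_or_hyperplanes reflexive_space by blast
qed

end
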